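(* Let $p=(p_i)_{i=1}^n$ and $q=(q_i)_{i=1}^n$ be classical probability distributions on $[n]$, given by purified quantum query-access oracles $U_p$ and $U_q$, and let $\nu\in(0,1]$ and $\epsilon\in(0,1)$. Then the explicit algorithm $\mathcal{T}$ specified in the context (amplitude estimation applied to the unitary $U$ and projector $\Pi$ with parameter $t=\frac{10\pi}{\nu\epsilon}$, followed by comparison with the threshold $(\frac14-\frac{\nu}{8})\epsilon^2$) can decide whether $\|p-q\|_2\le(1-\nu)\epsilon$ or $\|p-q\|_2\ge\epsilon$ (under the promise that one of the two holds) with probability at least $\frac23$: it outputs CLOSE in the first case and FAR in the second, each with probability at least $\frac23$. It uses $O\!\left(\frac{1}{\nu\epsilon}\right)$ calls to $U_p$, $U_q$, their inverses or their controlled versions.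
   Context: Notation: $[n]=\{1,\dots,n\}$, and $\|p-q\|_2:=\left(\sum_{i=1}^n|p_i-q_i|^2\right)^{1/2}$. For an operator $V$ and a subsystem $S$, $(V)_S$ means that $V$ acts on $S$ and the other subsystems are unchanged. Purified quantum query-access: a classical distribution $(p_i)_{i=1}^n$ has purified quantum query-access if one has access to a unitary oracle $U_p$ (and its inverse and controlled versions) acting as $$U_p|0\rangle_A|0\rangle_B=\sum_{i=1}^n\sqrt{p_i}\,|\phi_i\rangle_A|i\rangle_B,\qquad \langle\phi_i|\phi_j\rangle=\delta_{ij}.$$ Here $B=\mathbb{C}^n=\mathrm{span}\{|1\rangle,\dots,|n\rangle\}$ with orthonormal basis $|1\rangle,\dots,|n\rangle$, and $|0\rangle_A,|0\rangle_B$ are fixed reference unit vectors. The oracle $U_q$ has the same form for $q$ (with its own orthonormal vectors in place of the $|\phi_i\rangle$), on the same systems with the same reference vectors. Amplitude estimation (Brassard et al.): given a unitary $U$ and an orthogonal projector $\Pi$ such that $U|0\rangle=\sqrt{a}\,|\phi\rangle+\sqrt{1-a}\,|\phi^\perp\rangle$ for some $a\in[0,1]$, with $\Pi|\phi\rangle=|\phi\rangle$ and $\Pi|\phi^\perp\rangle=0$, this is a known quantum algorithm that, using $t$ calls to $U$, $U^\dagger$ and $I-2\Pi$, outputs $\tilde a$ such that $|\tilde a-a|\le 2\pi\frac{\sqrt{a(1-a)}}{t}+\frac{\pi^2}{t^2}$ with probability at least $8/\pi^2$. Algorithm $\mathcal{T}$. Input: the oracles for $p$ and $q$, and real numbers $\nu\in(0,1]$,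 $\epsilon\in(0,1)$. Step 1. Prepare the initial state $|\psi_0\rangle=|0\rangle_A|0\rangle_B|0\rangle_C|0\rangle_D$, where $C$ has the same dimension as $B$ (with a basis $|1\rangle,\dots,|n\rangle$ and a fixed reference unit vector $|0\rangle_C$) and $D$ is a qubit. Step 2. Apply to $|\psi_0\rangle$ the unitary $$U:=(H)_D\left(\tilde U_p\otimes|0\rangle\langle0|+\tilde U_q\otimes|1\rangle\langle1|\right)_{ABCD}(HX)_D,$$ where $\tilde U_p:=(U_p^\dagger)_{AB}(U_{copy})_{BC}(U_p)_{AB}$, $\tilde U_q$ is defined in the same way from $U_q$, $U_{copy}$ is a unitary mapping $|i\rangle|0\rangle\mapsto|i\rangle|i\rangle$ for $i=1,\dots,n$, $H$ is the Hadamard gate and $X$ is the Pauli-X gate. Step 3. Run amplitude estimation with this $U$ (started from $|\psi_0\rangle$), the projector $\Pi:=|0\rangle\langle0|_A\otimes|0\rangle\langle0|_B\otimes I_C\otimes|0\rangle\langle0|_D$, and $t:=\frac{10\pi}{\nu\epsilon}$ (rounded up to an integer). Denote the result by $\Delta'$. Step 4. If $\Delta'<\left(\frac14-\frac{\nu}{8}\right)\epsilon^2$, output CLOSE; otherwise output FAR. *)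

theory Defs
  imports Complex_Main "Jordan_Normal_Form.Schur_Decomposition"
begin

text \<open>Composite systems use the lexicographic order of the product basis: the basis vector
  \<open>|i\<rangle>|j\<rangle>\<close> of a \<open>k\<close>-dimensional and an \<open>l\<close>-dimensional system has index \<open>i * l + j\<close>.\<close>

definition tensor_vec :: "complex vec \<Rightarrow> complex vec \<Rightarrow> complex vec" (infixr "\<otimes>\<^sub>v" 73) where
  "u \<otimes>\<^sub>v v = vec (dim_vec u * dim_vec v)
     (\<lambda>i. u $ (i div dim_vec v) * v $ (i mod dim_vec v))"

definition tensor_mat :: "complex mat \<Rightarrow> complex mat \<Rightarrow> complex mat" (infixr "\<otimes>\<^sub>m" 73) where
  "A \<otimes>\<^sub>m B = mat (dim_row A * dim_row B) (dim_col A * dim_col B)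
     (\<lambda>(i, j). A $$ (i div dim_row B, j div dim_col B) * B $$ (i mod dim_row B, j mod dim_col B))"

definition unitary_mat :: "nat \<Rightarrow> complex mat \<Rightarrow> bool" where
  "unitary_mat d U \<longleftrightarrow> U \<in> carrier_mat d d \<and>
     mat_adjoint U * U = 1\<^sub>m d \<and> U * mat_adjoint U = 1\<^sub>m d"

definition ket_bra :: "complex vec \<Rightarrow> complex mat" where
  "ket_bra v = mat (dim_vec v) (dim_vec v) (\<lambda>(i, j). v $ i * cnj (v $ j))"

text \<open>\<open>v \<bullet>c w\<close> is conjugate-linear in \<open>w\<close>, that is, it is \<open>\<langle>w|v\<rangle>\<close>.\<close>

definition unit_vector :: "nat \<Rightarrow> complex vec \<Rightarrow> bool" where
  "unit_vector d v \<longleftrightarrow> v \<in> carrier_vec d \<and> v \<bullet>c v = 1"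

definition hadamard :: "complex mat" where
  "hadamard = mat 2 2 (\<lambda>(i, j). (if i = 1 \<and> j = 1 then -1 else 1) / complex_of_real (sqrt 2))"

definition pauli_x :: "complex mat" where
  "pauli_x = mat 2 2 (\<lambda>(i, j). if i = j then 0 else 1)"

text \<open>The outcome set \<open>[n]\<close> is represented by \<open>{..<n}\<close>, and the basis vector \<open>|i\<rangle>\<close> by
  \<open>unit_vec n i\<close>.\<close>

definition distribution :: "nat \<Rightarrow> (nat \<Rightarrow> real) \<Rightarrow> bool" where
  "distribution n p \<longleftrightarrow> (\<forall>i<n. 0 \<le> p i) \<and> (\<Sum>i<n. p i) = 1"

definition l2_dist :: "nat \<Rightarrow> (nat \<Rightarrow> real) \<Rightarrow> (nat \<Rightarrow> real) \<Rightarrow> real" where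
  "l2_dist n p q = sqrt (\<Sum>i<n. \<bar>p i - q i\<bar>\<^sup>2)"

text \<open>System \<open>A\<close> has dimension \<open>m\<close>, system \<open>B\<close> has dimension \<open>n\<close>;
  \<open>zA\<close> and \<open>zB\<close> are the reference vectors \<open>|0\<rangle>\<^sub>A\<close> and \<open>|0\<rangle>\<^sub>B\<close>.\<close>

definition purified_access ::
  "nat \<Rightarrow> nat \<Rightarrow> complex vec \<Rightarrow> complex vec \<Rightarrow> (nat \<Rightarrow> real) \<Rightarrow> complex mat \<Rightarrow> bool" where
  "purified_access m n zA zB p U \<longleftrightarrow> unitary_mat (m * n) U \<and>
     (\<exists>\<phi>. (\<forall>i<n. \<phi> i \<in> carrier_vec m) \<and>
          (\<forall>i<n. \<forall>j<n. \<phi> j \<bullet>c \<phi> i = (if i = j then 1 else 0)) \<and>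
          U *\<^sub>v (zA \<otimes>\<^sub>v zB) =
            finsum_vec TYPE(complex) (m * n)
              (\<lambda>i. complex_of_real (sqrt (p i)) \<cdot>\<^sub>v (\<phi> i \<otimes>\<^sub>v unit_vec n i)) {..<n})"

definition copy_unitary :: "nat \<Rightarrow> complex vec \<Rightarrow> complex mat \<Rightarrow> bool" where
  "copy_unitary n zC V \<longleftrightarrow> unitary_mat (n * n) V \<and>
     (\<forall>i<n. V *\<^sub>v (unit_vec n i \<otimes>\<^sub>v zC) = unit_vec n i \<otimes>\<^sub>v unit_vec n i)"

text \<open>The full register is \<open>E \<otimes> A \<otimes> B \<otimes> C \<otimes> D\<close> with dimensions \<open>t, m, n, n, 2\<close>, where \<open>E\<close> is the
  clock register of amplitude estimation. A circuit is a list of gates in order of application.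
  Circuits are built without reference to the oracle unitaries: the matrix in \<open>Fixed\<close> acts on the
  full register and does not depend on them, and the oracles enter only through \<open>Call_p\<close> and
  \<open>Call_q\<close> (acting on \<open>AB\<close>), when the circuit is interpreted. \<open>Controlled b g\<close> applies \<open>g\<close> if the
  qubit \<open>D\<close> is in state \<open>|b\<rangle>\<close>; it is only meaningful for gates \<open>g\<close> that do not act on \<open>D\<close>.\<close>

datatype gate = Fixed "complex mat" | Call_p | Call_q | Inverse gate | Controlled nat gate

definition proj_D :: "nat \<Rightarrow> nat \<Rightarrow> nat \<Rightarrow> nat \<Rightarrow> complex mat" where
  "proj_D t m n b = 1\<^sub>m (t * m * n * n) \<otimes>\<^sub>m ket_bra (unit_vec 2 b)"

fun gate_op :: "nat \<Rightarrow> nat \<Rightarrow> nat \<Rightarrow> complex mat \<Rightarrow> complex mat \<Rightarrow> gate \<Rightarrow> complex mat" where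
  "gate_op t m n Up Uq (Fixed M) = M"
| "gate_op t m n Up Uq Call_p = 1\<^sub>m t \<otimes>\<^sub>m Up \<otimes>\<^sub>m 1\<^sub>m n \<otimes>\<^sub>m 1\<^sub>m 2"
| "gate_op t m n Up Uq Call_q = 1\<^sub>m t \<otimes>\<^sub>m Uq \<otimes>\<^sub>m 1\<^sub>m n \<otimes>\<^sub>m 1\<^sub>m 2"
| "gate_op t m n Up Uq (Inverse g) = mat_adjoint (gate_op t m n Up Uq g)"
| "gate_op t m n Up Uq (Controlled b g) =
     gate_op t m n Up Uq g * proj_D t m n b + proj_D t m n (1 - b)"

definition run_circuit ::
  "nat \<Rightarrow> nat \<Rightarrow> nat \<Rightarrow> complex mat \<Rightarrow> complex mat \<Rightarrow> gate list \<Rightarrow> complex vec \<Rightarrow> complex vec" where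
  "run_circuit t m n Up Uq c \<psi> = fold (\<lambda>g \<chi>. gate_op t m n Up Uq g *\<^sub>v \<chi>) c \<psi>"

definition inverse_circuit :: "gate list \<Rightarrow> gate list" where
  "inverse_circuit c = rev (map Inverse c)"

definition controlled_circuit :: "nat \<Rightarrow> gate list \<Rightarrow> gate list" where
  "controlled_circuit b c = map (Controlled b) c"

text \<open>Every use of an oracle, of its inverse or of a controlled version counts as one call.\<close>

fun gate_calls :: "gate \<Rightarrow> nat" where
  "gate_calls (Fixed M) = 0"
| "gate_calls Call_p = 1"
| "gate_calls Call_q = 1"
| "gate_calls (Inverse g) = gate_calls g"
| "gate_calls (Controlled b g) = gate_calls g"

definition num_calls :: "gate list \<Rightarrow> nat" where
  "num_calls c = sum_list (map gate_calls c)"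

text \<open>The algorithm of Brassard, Hoyer, Mosca and Tapp for a subroutine \<open>U\<close> (given as a circuit
  \<open>cU\<close> on the full register that acts trivially on \<open>E\<close>), an initial vector \<open>\<psi>\<close> and a projector
  \<open>P\<close> on the \<open>s\<close>-dimensional work system: apply the Fourier transform to \<open>E\<close> and \<open>U\<close> to the work
  system, then \<open>\<Sum>\<^sub>j |j\<rangle>\<langle>j| \<otimes> Q\<^sup>j\<close> for the Grover iterate
  \<open>Q = - U (I - 2|\<psi>\<rangle>\<langle>\<psi>|) U\<^sup>\<dagger> (I - 2P)\<close>, and then the inverse Fourier transform on \<open>E\<close>. Measuring
  \<open>y\<close> in \<open>E\<close> yields the estimate \<open>sin\<^sup>2(\<pi> y / t)\<close>.

  The operator \<open>\<Sum>\<^sub>j |j\<rangle>\<langle>j| \<otimes> Q\<^sup>j\<close> is the product over \<open>k = 1, \<dots>, t - 1\<close> of \<open>Q\<close> controlled on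
  \<open>j \<ge> k\<close>. In a controlled \<open>Q\<close> it suffices to control the two reflections (the sign of \<open>Q\<close> being
  absorbed in the second one), since \<open>U\<close> and \<open>U\<^sup>\<dagger>\<close> cancel when these are switched off. In total
  there are \<open>t\<close> uses of \<open>U\<close>, \<open>t - 1\<close> of \<open>U\<^sup>\<dagger>\<close> and \<open>t - 1\<close> of the reflection \<open>I - 2P\<close>.\<close>

definition dft_mat :: "nat \<Rightarrow> complex mat" where
  "dft_mat t = mat t t (\<lambda>(j, k). cis (2 * pi * real j * real k / real t) / complex_of_real (sqrt (real t)))"

definition proj_ge :: "nat \<Rightarrow> nat \<Rightarrow> complex mat" where
  "proj_ge t k = mat t t (\<lambda>(i, j). if i = j \<and> k \<le> i then 1 else 0)"

definition ctrl_ge :: "nat \<Rightarrow> nat \<Rightarrow> nat \<Rightarrow> complex mat \<Rightarrow> complex mat" where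
  "ctrl_ge t s k V = (1\<^sub>m t - proj_ge t k) \<otimes>\<^sub>m 1\<^sub>m s + proj_ge t k \<otimes>\<^sub>m V"

definition amp_est_circuit ::
  "nat \<Rightarrow> nat \<Rightarrow> complex vec \<Rightarrow> complex mat \<Rightarrow> gate list \<Rightarrow> gate list" where
  "amp_est_circuit t s \<psi> P cU =
     [Fixed (dft_mat t \<otimes>\<^sub>m 1\<^sub>m s)] @ cU @
     concat (map (\<lambda>k.
       [Fixed (ctrl_ge t s k (1\<^sub>m s - 2 \<cdot>\<^sub>m P))] @
       inverse_circuit cU @
       [Fixed (ctrl_ge t s k (2 \<cdot>\<^sub>m ket_bra \<psi> - 1\<^sub>m s))] @
       cU) [1..<t]) @
     [Fixed (mat_adjoint (dft_mat t) \<otimes>\<^sub>m 1\<^sub>m s)]"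

definition amp_est_value :: "nat \<Rightarrow> nat \<Rightarrow> real" where
  "amp_est_value t y = (sin (pi * real y / real t))\<^sup>2"

text \<open>Born rule: the probability that measuring the first (\<open>t\<close>-dimensional) register in the
  computational basis yields \<open>y\<close>.\<close>

definition outcome_prob :: "nat \<Rightarrow> nat \<Rightarrow> complex vec \<Rightarrow> nat \<Rightarrow> real" where
  "outcome_prob t s \<chi> y =
     (let v = (ket_bra (unit_vec t y) \<otimes>\<^sub>m 1\<^sub>m s) *\<^sub>v \<chi> in Re (v \<bullet>c v))"

definition init_state :: "complex vec \<Rightarrow> complex vec \<Rightarrow> complex vec \<Rightarrow> complex vec" where
  "init_state zA zB zC = zA \<otimes>\<^sub>v zB \<otimes>\<^sub>v zC \<otimes>\<^sub>v unit_vec 2 0"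

definition tilde_circuit :: "nat \<Rightarrow> nat \<Rightarrow> complex mat \<Rightarrow> gate \<Rightarrow> gate list" where
  "tilde_circuit t m Ucopy g = [g, Fixed (1\<^sub>m t \<otimes>\<^sub>m 1\<^sub>m m \<otimes>\<^sub>m Ucopy \<otimes>\<^sub>m 1\<^sub>m 2), Inverse g]"

definition U_circuit :: "nat \<Rightarrow> nat \<Rightarrow> nat \<Rightarrow> complex mat \<Rightarrow> gate list" where
  "U_circuit t m n Ucopy =
     [Fixed (1\<^sub>m (t * m * n * n) \<otimes>\<^sub>m (hadamard * pauli_x))] @
     controlled_circuit 0 (tilde_circuit t m Ucopy Call_p) @
     controlled_circuit 1 (tilde_circuit t m Ucopy Call_q) @
     [Fixed (1\<^sub>m (t * m * n * n) \<otimes>\<^sub>m hadamard)]"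

definition Pi_proj :: "nat \<Rightarrow> complex vec \<Rightarrow> complex vec \<Rightarrow> complex mat" where
  "Pi_proj n zA zB = ket_bra zA \<otimes>\<^sub>m ket_bra zB \<otimes>\<^sub>m 1\<^sub>m n \<otimes>\<^sub>m ket_bra (unit_vec 2 0)"

definition T_iterations :: "real \<Rightarrow> real \<Rightarrow> nat" where
  "T_iterations \<nu> \<epsilon> = nat \<lceil>10 * pi / (\<nu> * \<epsilon>)\<rceil>"

definition T_circuit ::
  "nat \<Rightarrow> nat \<Rightarrow> complex vec \<Rightarrow> complex vec \<Rightarrow> complex vec \<Rightarrow> complex mat \<Rightarrow> real \<Rightarrow> real \<Rightarrow> gate list" where
  "T_circuit m n zA zB zC Ucopy \<nu> \<epsilon> =
     (let t = T_iterations \<nu> \<epsilon> in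
      amp_est_circuit t (m * n * n * 2) (init_state zA zB zC) (Pi_proj n zA zB)
        (U_circuit t m n Ucopy))"

datatype decision = CLOSE | FAR

definition T_decision :: "real \<Rightarrow> real \<Rightarrow> real \<Rightarrow> decision" where
  "T_decision \<nu> \<epsilon> \<Delta>' = (if \<Delta>' < (1/4 - \<nu>/8) * \<epsilon>\<^sup>2 then CLOSE else FAR)"

definition T_prob ::
  "nat \<Rightarrow> nat \<Rightarrow> complex vec \<Rightarrow> complex vec \<Rightarrow> complex vec \<Rightarrow> complex mat \<Rightarrow> real \<Rightarrow> real \<Rightarrow>
   complex mat \<Rightarrow> complex mat \<Rightarrow> decision \<Rightarrow> real" where
  "T_prob m n zA zB zC Ucopy \<nu> \<epsilon> Up Uq d =
     (let t = T_iterations \<nu> \<epsilon>;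
          \<chi> = run_circuit t m n Up Uq (T_circuit m n zA zB zC Ucopy \<nu> \<epsilon>)
                (unit_vec t 0 \<otimes>\<^sub>v init_state zA zB zC)
      in \<Sum>y | y < t \<and> T_decision \<nu> \<epsilon> (amp_est_value t y) = d.
           outcome_prob t (m * n * n * 2) \<chi> y)"

end

theory Submission
  imports Defs
begin

text \<open>Let \<open>\<Psi> = U|\<psi>\<^sub>0\<rangle>\<close>. On the branches \<open>|0\<rangle>\<close> and \<open>|1\<rangle>\<close> of \<open>D\<close> the \<open>|0\<rangle>|0\<rangle>\<close>-component of \<open>AB\<close>
  carries \<open>\<Sum>\<^sub>i p\<^sub>i|i\<rangle>\<close> and \<open>\<Sum>\<^sub>i q\<^sub>i|i\<rangle>\<close> in \<open>C\<close>, and the final Hadamard gate subtracts them; hence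
  \<open>\<parallel>\<Pi>\<Psi>\<parallel>\<^sup>2 = (\<parallel>p - q\<parallel>/2)\<^sup>2 = sin\<^sup>2 \<theta>\<close>.

  The Grover iterate rotates \<open>\<Psi>\<close> in the plane of \<open>\<Pi>\<Psi>\<close> and \<open>\<Psi> - \<Pi>\<Psi>\<close> by \<open>2\<theta>\<close>, so the outcome \<open>y\<close> of the
  phase estimation has probability \<open>(F(2\<theta> - 2\<pi>y/t) + F(2\<theta> + 2\<pi>y/t))/2\<close> with the Fejer kernel
  \<open>F(\<alpha>) = |\<Sum>\<^sub>j exp(ij\<alpha>)|\<^sup>2/t\<^sup>2\<close>. Each of the two kernels puts mass at least \<open>2/3\<close> on two adjacent
  outcomes, for which \<open>|sin(\<pi>y/t)|\<close> differs from \<open>sin \<theta>\<close> by at most \<open>\<pi>/t \<le> \<nu>\<epsilon>/10\<close>. Comparing the sines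
  instead of their squares makes the decision rule a short computation.\<close>

section \<open>Tensor products and adjoints\<close>

text \<open>The guarantee of amplitude estimation is derived from the circuit, not assumed. No
  eigenvectors of the Grover iterate are used: its powers are expanded in the unnormalised vectors
  \<Pi>\<Psi> and \<Psi> - \<Pi>\<Psi>, and the coefficients are needed only after multiplication by
  sin \<theta> and cos \<theta>. Hence the degenerate angles, such as \<theta> = 0 for p = q, cause
  no case distinction.

  The usual success probability is 8/pi^2, about 0.81, but the claim asks for 2/3 only. This slack
  pays for replacing the sine by a cubic and pi^2 by 10, which leaves a polynomial inequality in one
  variable.

  The 10 in t is explained by the gap between the two cases: sin \<theta> is at most (1 -
  \<nu>)\<epsilon>/2 or at least \<epsilon>/2, so the cases are \<nu>\<epsilon>/2 apart, and an
  error of at most \<nu>\<epsilon>/10 on either side leaves room for the threshold.\<close>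

lemma sum_div_mod:
  fixes f :: "nat \<Rightarrow> nat \<Rightarrow> 'a::comm_monoid_add"
  shows "(\<Sum>k<a * b. f (k div b) (k mod b)) = (\<Sum>i<a. \<Sum>j<b. f i j)"
proof -
  have "(\<Sum>k<a * b. f (k div b) (k mod b)) = (\<Sum>i<a. \<Sum>k\<in>{i*b..<i*b+b}. f (k div b) (k mod b))"
    by (rule sum.nat_group[symmetric])
  also have "\<dots> = (\<Sum>i<a. \<Sum>j<b. f i j)"
  proof (rule sum.cong[OF refl])
    fix i
    show "(\<Sum>k\<in>{i*b..<i*b+b}. f (k div b) (k mod b)) = (\<Sum>j<b. f i j)"
      by (rule sum.reindex_bij_witness[of _ "\<lambda>j. i*b+j" "\<lambda>k. k - i*b"])
         (auto simp: le_iff_add)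
  qed
  finally show ?thesis .
qed

text \<open>Brings entries into the form of sums over \<open>{..<n}\<close>, to which
  \<open>sum_div_mod\<close> and \<open>sum.swap\<close> apply. Proofs that rely on this form switch
  off the competing simp rules for entries.\<close>

lemma index_mult_mat_vec_sum:
  assumes "i < dim_row A" "dim_col A = dim_vec v"
  shows "(A *\<^sub>v v) $ i = (\<Sum>j<dim_vec v. A $$ (i, j) * v $ j)"
  using assms by (simp add: scalar_prod_def atLeast0LessThan)

lemma index_mult_mat_sum:
  assumes "i < dim_row A" "j < dim_col B" "dim_col A = dim_row B"
  shows "(A * B) $$ (i, j) = (\<Sum>k<dim_row B. A $$ (i, k) * B $$ (k, j))"
  using assms by (simp add: scalar_prod_def atLeast0LessThan)

lemma cscalar_prod_sum: "v \<bullet>c w = (\<Sum>i<dim_vec w. v $ i * cnj (w $ i))" for v w :: "complex vec"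
  by (simp add: scalar_prod_def atLeast0LessThan)

lemma mat_adjoint_dim [simp]:
  "dim_row (mat_adjoint A) = dim_col A" "dim_col (mat_adjoint A) = dim_row A"
  by (auto simp: mat_adjoint_def)

lemma mat_adjoint_carrier [simp]:
  "A \<in> carrier_mat r c \<Longrightarrow> mat_adjoint A \<in> carrier_mat c r"
  by (intro carrier_matI) auto

lemma mat_adjoint_index [simp]:
  fixes A :: "complex mat"
  shows "i < dim_col A \<Longrightarrow> j < dim_row A \<Longrightarrow> mat_adjoint A $$ (i, j) = cnj (A $$ (j, i))"
  by (simp add: mat_adjoint_def mat_of_rows_def)

lemma mat_adjoint_mult:
  fixes A B :: "complex mat"
  assumes "dim_col A = dim_row B"
  shows "mat_adjoint (A * B) = mat_adjoint B * mat_adjoint A"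
  by (rule eq_matI) (use assms in \<open>auto simp: index_mult_mat_sum mult.commute simp del: index_mult_mat(1)\<close>)

lemma mat_adjoint_add:
  fixes A B :: "complex mat"
  assumes "dim_row A = dim_row B" "dim_col A = dim_col B"
  shows "mat_adjoint (A + B) = mat_adjoint A + mat_adjoint B"
  by (rule eq_matI) (use assms in auto)

lemma mat_adjoint_adjoint [simp]: "mat_adjoint (mat_adjoint A) = A" for A :: "complex mat"
  by (rule eq_matI) auto

lemma mat_adjoint_one [simp]: "mat_adjoint (1\<^sub>m k :: complex mat) = 1\<^sub>m k"
  by (rule eq_matI) auto

lemma cscalar_prod_adjoint:
  fixes A :: "complex mat"
  assumes "A \<in> carrier_mat r c" "v \<in> carrier_vec c" "w \<in> carrier_vec r"
  shows "(A *\<^sub>v v) \<bullet>c w = v \<bullet>c (mat_adjoint A *\<^sub>v w)"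
proof -
  have "(A *\<^sub>v v) \<bullet>c w = (\<Sum>i<r. \<Sum>j<c. A $$ (i, j) * v $ j * cnj (w $ i))"
    using assms by (simp add: cscalar_prod_sum index_mult_mat_vec_sum sum_distrib_right del: index_mult_mat_vec)
  also have "\<dots> = (\<Sum>j<c. \<Sum>i<r. A $$ (i, j) * v $ j * cnj (w $ i))"
    by (rule sum.swap)
  also have "\<dots> = v \<bullet>c (mat_adjoint A *\<^sub>v w)"
    using assms by (simp add: cscalar_prod_sum index_mult_mat_vec_sum sum_distrib_left mult_ac del: index_mult_mat_vec)
  finally show ?thesis .
qed

lemma tensor_vec_dim [simp]: "dim_vec (u \<otimes>\<^sub>v v) = dim_vec u * dim_vec v"
  by (simp add: tensor_vec_def)

lemma tensor_vec_carrier [simp]: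
  "u \<in> carrier_vec a \<Longrightarrow> v \<in> carrier_vec b \<Longrightarrow> u \<otimes>\<^sub>v v \<in> carrier_vec (a * b)"
  by (intro carrier_vecI) simp

lemma tensor_mat_dim [simp]:
  "dim_row (A \<otimes>\<^sub>m B) = dim_row A * dim_row B" "dim_col (A \<otimes>\<^sub>m B) = dim_col A * dim_col B"
  by (simp_all add: tensor_mat_def)

lemma tensor_mat_carrier [simp]:
  "A \<in> carrier_mat a b \<Longrightarrow> B \<in> carrier_mat c d \<Longrightarrow> A \<otimes>\<^sub>m B \<in> carrier_mat (a * c) (b * d)"
  by (intro carrier_matI) auto

lemma tensor_index_bounds:
  fixes k a b :: nat
  assumes "k < a * b" shows "k div b < a" "k mod b < b"
proof -
  have "0 < b" using assms by (cases b) auto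
  then show "k div b < a" "k mod b < b" using assms by (auto simp: less_mult_imp_div_less)
qed

lemma tensor_vec_index [simp]:
  "i < dim_vec u * dim_vec v \<Longrightarrow> (u \<otimes>\<^sub>v v) $ i = u $ (i div dim_vec v) * v $ (i mod dim_vec v)"
  by (simp add: tensor_vec_def)

lemma tensor_mat_index [simp]:
  "i < dim_row A * dim_row B \<Longrightarrow> j < dim_col A * dim_col B \<Longrightarrow> (A \<otimes>\<^sub>m B) $$ (i, j) =
     A $$ (i div dim_row B, j div dim_col B) * B $$ (i mod dim_row B, j mod dim_col B)"
  by (simp add: tensor_mat_def)

text \<open>\<open>sum_div_mod\<close> turns the sum over the composite index into a double sum,
  whose summand is a product and therefore factors. The product and inner product rules below follow
  the same way.\<close>

lemma tensor_mat_mult_vec: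
  assumes "dim_col A = dim_vec u" "dim_col B = dim_vec v"
  shows "(A \<otimes>\<^sub>m B) *\<^sub>v (u \<otimes>\<^sub>v v) = (A *\<^sub>v u) \<otimes>\<^sub>v (B *\<^sub>v v)"
proof (rule eq_vecI)
  fix i assume "i < dim_vec ((A *\<^sub>v u) \<otimes>\<^sub>v (B *\<^sub>v v))"
  then have i: "i < dim_row A * dim_row B" by simp
  note ib = tensor_index_bounds[OF i]
  let ?a = "i div dim_row B" and ?b = "i mod dim_row B"
  have "((A \<otimes>\<^sub>m B) *\<^sub>v (u \<otimes>\<^sub>v v)) $ i = (\<Sum>k<dim_vec u * dim_vec v.
      (A $$ (?a, k div dim_vec v) * B $$ (?b, k mod dim_vec v)) * (u $ (k div dim_vec v) * v $ (k mod dim_vec v)))"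
    using i assms by (simp add: index_mult_mat_vec_sum del: index_mult_mat_vec)
  also have "\<dots> = (\<Sum>k<dim_vec u. \<Sum>l<dim_vec v. (A $$ (?a, k) * B $$ (?b, l)) * (u $ k * v $ l))"
    by (rule sum_div_mod)
  also have "\<dots> = (\<Sum>k<dim_vec u. A $$ (?a, k) * u $ k) * (\<Sum>l<dim_vec v. B $$ (?b, l) * v $ l)"
    by (simp add: sum_product mult_ac)
  also have "\<dots> = ((A *\<^sub>v u) \<otimes>\<^sub>v (B *\<^sub>v v)) $ i"
    using i ib assms by (simp add: index_mult_mat_vec_sum del: index_mult_mat_vec)
  finally show "((A \<otimes>\<^sub>m B) *\<^sub>v (u \<otimes>\<^sub>v v)) $ i = ((A *\<^sub>v u) \<otimes>\<^sub>v (B *\<^sub>v v)) $ i" .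
qed simp

lemma tensor_mat_mult:
  assumes "dim_col A = dim_row C" "dim_col B = dim_row D"
  shows "(A \<otimes>\<^sub>m B) * (C \<otimes>\<^sub>m D) = (A * C) \<otimes>\<^sub>m (B * D)"
proof (rule eq_matI)
  fix i j assume "i < dim_row ((A * C) \<otimes>\<^sub>m (B * D))" "j < dim_col ((A * C) \<otimes>\<^sub>m (B * D))"
  then have i: "i < dim_row A * dim_row B" and j: "j < dim_col C * dim_col D" by simp_all
  note ib = tensor_index_bounds[OF i] tensor_index_bounds[OF j]
  let ?a = "i div dim_row B" and ?b = "i mod dim_row B"
  let ?c = "j div dim_col D" and ?d = "j mod dim_col D"
  have "((A \<otimes>\<^sub>m B) * (C \<otimes>\<^sub>m D)) $$ (i, j) = (\<Sum>k<dim_row C * dim_row D.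
      (A $$ (?a, k div dim_row D) * B $$ (?b, k mod dim_row D)) *
      (C $$ (k div dim_row D, ?c) * D $$ (k mod dim_row D, ?d)))"
    using i j assms by (simp add: index_mult_mat_sum del: index_mult_mat)
  also have "\<dots> = (\<Sum>k<dim_row C. \<Sum>l<dim_row D. (A $$ (?a, k) * B $$ (?b, l)) * (C $$ (k, ?c) * D $$ (l, ?d)))"
    by (rule sum_div_mod)
  also have "\<dots> = (\<Sum>k<dim_row C. A $$ (?a, k) * C $$ (k, ?c)) * (\<Sum>l<dim_row D. B $$ (?b, l) * D $$ (l, ?d))"
    by (simp add: sum_product mult_ac)
  also have "\<dots> = ((A * C) \<otimes>\<^sub>m (B * D)) $$ (i, j)"
    using i j ib assms by (simp add: index_mult_mat_sum del: index_mult_mat(1))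
  finally show "((A \<otimes>\<^sub>m B) * (C \<otimes>\<^sub>m D)) $$ (i, j) = ((A * C) \<otimes>\<^sub>m (B * D)) $$ (i, j)" .
qed simp_all

lemma tensor_mat_adjoint: "mat_adjoint (A \<otimes>\<^sub>m B) = mat_adjoint A \<otimes>\<^sub>m mat_adjoint B"
  by (rule eq_matI) (auto simp: tensor_index_bounds)

lemma tensor_cscalar_prod:
  assumes "dim_vec u = dim_vec u'" "dim_vec v = dim_vec v'"
  shows "(u \<otimes>\<^sub>v v) \<bullet>c (u' \<otimes>\<^sub>v v') = (u \<bullet>c u') * (v \<bullet>c v')"
proof -
  have "(u \<otimes>\<^sub>v v) \<bullet>c (u' \<otimes>\<^sub>v v') = (\<Sum>k<dim_vec u' * dim_vec v'.
      (u $ (k div dim_vec v') * v $ (k mod dim_vec v')) *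
      (cnj (u' $ (k div dim_vec v')) * cnj (v' $ (k mod dim_vec v'))))"
    using assms by (simp add: cscalar_prod_sum)
  also have "\<dots> = (\<Sum>k<dim_vec u'. \<Sum>l<dim_vec v'. (u $ k * v $ l) * (cnj (u' $ k) * cnj (v' $ l)))"
    by (rule sum_div_mod)
  finally show ?thesis by (simp add: cscalar_prod_sum sum_product mult_ac)
qed

text \<open>The three digits of a mixed-radix index do not depend on the bracketing; this is the
  content of associativity of the tensor products.\<close>

lemma div_mod_mult:
  fixes i b c :: nat
  shows "i div (b * c) = i div c div b" "i mod (b * c) div c = i div c mod b" "i mod (b * c) mod c = i mod c"
  by (cases "c = 0"; simp add: div_mult2_eq mult.commute[of b c] mod_mult2_eq)+

lemma tensor_vec_assoc: "(u \<otimes>\<^sub>v v) \<otimes>\<^sub>v w = u \<otimes>\<^sub>v v \<otimes>\<^sub>v w"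
proof (rule eq_vecI)
  fix i assume "i < dim_vec (u \<otimes>\<^sub>v v \<otimes>\<^sub>v w)"
  then have i: "i < dim_vec u * (dim_vec v * dim_vec w)" by simp
  then have i': "i < (dim_vec u * dim_vec v) * dim_vec w" by (simp add: mult.assoc)
  show "((u \<otimes>\<^sub>v v) \<otimes>\<^sub>v w) $ i = (u \<otimes>\<^sub>v v \<otimes>\<^sub>v w) $ i"
    using i i' tensor_index_bounds[OF i] tensor_index_bounds[OF i'] by (simp add: div_mod_mult mult.assoc)
qed (simp add: mult.assoc)

lemma tensor_mat_assoc: "(A \<otimes>\<^sub>m B) \<otimes>\<^sub>m C = A \<otimes>\<^sub>m B \<otimes>\<^sub>m C"
proof (rule eq_matI)
  fix i j assume "i < dim_row (A \<otimes>\<^sub>m B \<otimes>\<^sub>m C)" "j < dim_col (A \<otimes>\<^sub>m B \<otimes>\<^sub>m C)"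
  then have i: "i < dim_row A * (dim_row B * dim_row C)" and j: "j < dim_col A * (dim_col B * dim_col C)"
    by simp_all
  then have i': "i < (dim_row A * dim_row B) * dim_row C" and j': "j < (dim_col A * dim_col B) * dim_col C"
    by (simp_all add: mult.assoc)
  show "((A \<otimes>\<^sub>m B) \<otimes>\<^sub>m C) $$ (i, j) = (A \<otimes>\<^sub>m B \<otimes>\<^sub>m C) $$ (i, j)"
    using i i' j j' tensor_index_bounds[OF i] tensor_index_bounds[OF i']
      tensor_index_bounds[OF j] tensor_index_bounds[OF j'] by (simp add: div_mod_mult mult.assoc)
qed (simp_all add: mult.assoc)

lemma tensor_mat_one: "1\<^sub>m a \<otimes>\<^sub>m 1\<^sub>m b = 1\<^sub>m (a * b)"
proof (rule eq_matI)
  fix i j assume "i < dim_row (1\<^sub>m (a * b) :: complex mat)" "j < dim_col (1\<^sub>m (a * b) :: complex mat)"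
  then have i: "i < a * b" and j: "j < a * b" by simp_all
  show "(1\<^sub>m a \<otimes>\<^sub>m 1\<^sub>m b) $$ (i, j) = (1\<^sub>m (a * b) :: complex mat) $$ (i, j)"
    using i j tensor_index_bounds[OF i] tensor_index_bounds[OF j]
    by auto (metis div_mult_mod_eq)+
qed simp_all

lemma tensor_vec_add_right:
  assumes "dim_vec v = dim_vec v'" shows "u \<otimes>\<^sub>v (v + v') = u \<otimes>\<^sub>v v + u \<otimes>\<^sub>v v'"
  by (rule eq_vecI) (use assms in \<open>auto simp: tensor_index_bounds algebra_simps\<close>)

lemma tensor_vec_smult_left: "(c \<cdot>\<^sub>v u) \<otimes>\<^sub>v v = c \<cdot>\<^sub>v (u \<otimes>\<^sub>v v)"
  by (rule eq_vecI) (auto simp: tensor_index_bounds)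

lemma tensor_vec_smult_right: "u \<otimes>\<^sub>v (c \<cdot>\<^sub>v v) = c \<cdot>\<^sub>v (u \<otimes>\<^sub>v v)"
  by (rule eq_vecI) (auto simp: tensor_index_bounds)

lemma tensor_mat_add_right:
  assumes "dim_row B = dim_row B'" "dim_col B = dim_col B'"
  shows "A \<otimes>\<^sub>m (B + B') = A \<otimes>\<^sub>m B + A \<otimes>\<^sub>m B'"
  by (rule eq_matI) (use assms in \<open>auto simp: tensor_index_bounds algebra_simps\<close>)

lemma tensor_mat_zero_right:
  "A \<otimes>\<^sub>m 0\<^sub>m a b = 0\<^sub>m (dim_row A * a) (dim_col A * b)"
  by (rule eq_matI) (auto simp: tensor_index_bounds)

lemma ket_bra_carrier [simp]: "v \<in> carrier_vec d \<Longrightarrow> ket_bra v \<in> carrier_mat d d"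
  by (simp add: ket_bra_def)

lemma ket_bra_dim [simp]: "dim_row (ket_bra v) = dim_vec v" "dim_col (ket_bra v) = dim_vec v"
  by (simp_all add: ket_bra_def)

lemma ket_bra_adjoint [simp]: "mat_adjoint (ket_bra v) = ket_bra v"
  by (rule eq_matI) (auto simp: ket_bra_def)

lemma ket_bra_mult_vec:
  assumes "dim_vec w = dim_vec v"
  shows "ket_bra v *\<^sub>v w = (w \<bullet>c v) \<cdot>\<^sub>v v"
  by (rule eq_vecI) (use assms in \<open>auto simp: ket_bra_def index_mult_mat_vec_sum cscalar_prod_sum
      sum_distrib_right sum_distrib_left mult_ac simp del: index_mult_mat_vec\<close>)

lemma ket_bra_idem:
  assumes "v \<bullet>c v = 1" shows "ket_bra v * ket_bra v = ket_bra v"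
proof (rule eq_matI)
  fix i j assume "i < dim_row (ket_bra v)" "j < dim_col (ket_bra v)"
  then have "(ket_bra v * ket_bra v) $$ (i, j) = (v $ i * cnj (v $ j)) * (v \<bullet>c v)"
    by (simp add: index_mult_mat_sum ket_bra_def cscalar_prod_sum sum_distrib_left mult_ac del: index_mult_mat)
  then show "(ket_bra v * ket_bra v) $$ (i, j) = ket_bra v $$ (i, j)"
    using assms \<open>i < _\<close> \<open>j < _\<close> by (simp add: ket_bra_def)
qed simp_all

lemma unitary_matD:
  assumes "unitary_mat d U"
  shows "U \<in> carrier_mat d d" "mat_adjoint U * U = 1\<^sub>m d" "U * mat_adjoint U = 1\<^sub>m d"
  using assms by (auto simp: unitary_mat_def)

lemma unitary_mat_adjoint: "unitary_mat d U \<Longrightarrow> unitary_mat d (mat_adjoint U)"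
  by (auto simp: unitary_mat_def)

lemma unitary_mat_one: "unitary_mat d (1\<^sub>m d)"
  by (simp add: unitary_mat_def)

lemma unitary_mat_mult:
  assumes "unitary_mat d U" "unitary_mat d V"
  shows "unitary_mat d (U * V)"
proof -
  note U = unitary_matD[OF assms(1)] and V = unitary_matD[OF assms(2)]
  have adj: "mat_adjoint (U * V) = mat_adjoint V * mat_adjoint U"
    using U V by (intro mat_adjoint_mult) auto
  have "mat_adjoint V * mat_adjoint U * (U * V) = mat_adjoint V * (mat_adjoint U * U * V)"
    using U(1) V(1) by (simp add: assoc_mult_mat[of _ d d _ d _ d])
  moreover have "U * V * (mat_adjoint V * mat_adjoint U) = U * (V * mat_adjoint V * mat_adjoint U)"
    using U(1) V(1) mult_carrier_mat[of "mat_adjoint V" d d "mat_adjoint U" d]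
    by (simp add: assoc_mult_mat[of _ d d _ d _ d])
  ultimately show ?thesis
    unfolding unitary_mat_def adj using U V by simp
qed

lemma unitary_mat_tensor:
  assumes "unitary_mat a U" "unitary_mat b V"
  shows "unitary_mat (a * b) (U \<otimes>\<^sub>m V)"
proof -
  note U = unitary_matD[OF assms(1)] and V = unitary_matD[OF assms(2)]
  then show ?thesis
    unfolding unitary_mat_def by (simp add: tensor_mat_adjoint tensor_mat_mult tensor_mat_one)
qed

lemma unitary_mat_cscalar_prod:
  assumes "unitary_mat d U" "v \<in> carrier_vec d" "w \<in> carrier_vec d"
  shows "(U *\<^sub>v v) \<bullet>c (U *\<^sub>v w) = v \<bullet>c w"
proof -
  note U = unitary_matD[OF assms(1)]
  have "(U *\<^sub>v v) \<bullet>c (U *\<^sub>v w) = v \<bullet>c (mat_adjoint U *\<^sub>v (U *\<^sub>v w))"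
    using U assms by (intro cscalar_prod_adjoint) auto
  also have "mat_adjoint U *\<^sub>v (U *\<^sub>v w) = w"
    using U assms by (simp flip: assoc_mult_mat_vec[of _ d d _ d])
  finally show ?thesis .
qed

section \<open>Circuits on clock and work register\<close>

text \<open>The whole register seen as one unnormalised work vector \<open>f j\<close> for each
  clock value \<open>j\<close>. Every stage of amplitude estimation is tracked in this form.\<close>

definition stack :: "nat \<Rightarrow> nat \<Rightarrow> (nat \<Rightarrow> complex vec) \<Rightarrow> complex vec" where
  "stack t s f = vec (t * s) (\<lambda>i. f (i div s) $ (i mod s))"

lemma stack_carrier [simp]: "stack t s f \<in> carrier_vec (t * s)"
  by (simp add: stack_def)

lemma stack_dim [simp]: "dim_vec (stack t s f) = t * s"
  by (simp add: stack_def)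

lemma stack_cong:
  assumes "\<And>j. j < t \<Longrightarrow> f j = g j" shows "stack t s f = stack t s g"
  by (rule eq_vecI) (auto simp: stack_def assms tensor_index_bounds)

lemma tensor_vec_stack:
  assumes "u \<in> carrier_vec t" "v \<in> carrier_vec s"
  shows "u \<otimes>\<^sub>v v = stack t s (\<lambda>j. u $ j \<cdot>\<^sub>v v)"
  by (rule eq_vecI) (use assms in \<open>auto simp: stack_def tensor_index_bounds\<close>)

lemma tensor_mat_stack:
  assumes "A \<in> carrier_mat t t" "W \<in> carrier_mat s s" "\<And>j. j < t \<Longrightarrow> f j \<in> carrier_vec s"
  shows "(A \<otimes>\<^sub>m W) *\<^sub>v stack t s f = stack t s (\<lambda>i. vec s (\<lambda>k. \<Sum>j<t. A $$ (i, j) * (W *\<^sub>v f j) $ k))"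
proof (rule eq_vecI)
  fix i assume "i < dim_vec (stack t s (\<lambda>i. vec s (\<lambda>k. \<Sum>j<t. A $$ (i, j) * (W *\<^sub>v f j) $ k)))"
  then have i: "i < t * s" by simp
  note ib = tensor_index_bounds[OF i]
  have "((A \<otimes>\<^sub>m W) *\<^sub>v stack t s f) $ i =
      (\<Sum>k<t * s. (A $$ (i div s, k div s) * W $$ (i mod s, k mod s)) * f (k div s) $ (k mod s))"
    using i assms by (simp add: index_mult_mat_vec_sum stack_def del: index_mult_mat_vec)
  also have "\<dots> = (\<Sum>j<t. \<Sum>l<s. (A $$ (i div s, j) * W $$ (i mod s, l)) * f j $ l)"
    by (rule sum_div_mod)
  also have "\<dots> = (\<Sum>j<t. A $$ (i div s, j) * (W *\<^sub>v f j) $ (i mod s))"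
  proof (rule sum.cong[OF refl])
    fix j assume "j \<in> {..<t}"
    then have "dim_vec (f j) = s" using assms(3) by auto
    then show "(\<Sum>l<s. (A $$ (i div s, j) * W $$ (i mod s, l)) * f j $ l) =
        A $$ (i div s, j) * (W *\<^sub>v f j) $ (i mod s)"
      using ib assms(1,2) by (simp add: index_mult_mat_vec_sum sum_distrib_left mult_ac del: index_mult_mat_vec)
  qed
  finally show "((A \<otimes>\<^sub>m W) *\<^sub>v stack t s f) $ i =
      stack t s (\<lambda>i. vec s (\<lambda>k. \<Sum>j<t. A $$ (i, j) * (W *\<^sub>v f j) $ k)) $ i"
    using i ib by (simp add: stack_def)
qed (use assms in auto)

text \<open>A diagonal clock factor does not mix clock values, so each block evolves on its own. In
  the run of the circuit only the final inverse Fourier transform needs the general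
  \<open>tensor_mat_stack\<close>.\<close>

lemma diag_tensor_stack:
  assumes "A \<in> carrier_mat t t" "W \<in> carrier_mat s s" "\<And>j. j < t \<Longrightarrow> f j \<in> carrier_vec s"
    and "\<And>i j. i < t \<Longrightarrow> j < t \<Longrightarrow> i \<noteq> j \<Longrightarrow> A $$ (i, j) = 0"
  shows "(A \<otimes>\<^sub>m W) *\<^sub>v stack t s f = stack t s (\<lambda>j. A $$ (j, j) \<cdot>\<^sub>v (W *\<^sub>v f j))"
proof -
  have "vec s (\<lambda>k. \<Sum>j<t. A $$ (i, j) * (W *\<^sub>v f j) $ k) = A $$ (i, i) \<cdot>\<^sub>v (W *\<^sub>v f i)"
    if i: "i < t" for i
  proof (rule eq_vecI)
    fix k assume "k < dim_vec (A $$ (i, i) \<cdot>\<^sub>v (W *\<^sub>v f i))"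
    then have k: "k < s" using assms(2) by simp
    have "(\<Sum>j<t. A $$ (i, j) * (W *\<^sub>v f j) $ k) = (\<Sum>j<t. if j = i then A $$ (i, i) * (W *\<^sub>v f i) $ k else 0)"
      by (rule sum.cong) (use assms(4) i in auto)
    then show "vec s (\<lambda>k. \<Sum>j<t. A $$ (i, j) * (W *\<^sub>v f j) $ k) $ k = (A $$ (i, i) \<cdot>\<^sub>v (W *\<^sub>v f i)) $ k"
      using i k assms(2) by (simp del: index_mult_mat_vec)
  qed (use assms(2) in auto)
  then show ?thesis
    using tensor_mat_stack[OF assms(1-3)] by (simp cong: stack_cong)
qed

lemma one_tensor_stack:
  assumes "W \<in> carrier_mat s s" "\<And>j. j < t \<Longrightarrow> f j \<in> carrier_vec s"
  shows "(1\<^sub>m t \<otimes>\<^sub>m W) *\<^sub>v stack t s f = stack t s (\<lambda>j. W *\<^sub>v f j)"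
  by (subst diag_tensor_stack[of _ t]) (use assms in \<open>auto intro!: stack_cong\<close>)

lemma stack_add:
  assumes "\<And>j. j < t \<Longrightarrow> f j \<in> carrier_vec s" "\<And>j. j < t \<Longrightarrow> g j \<in> carrier_vec s"
  shows "stack t s f + stack t s g = stack t s (\<lambda>j. f j + g j)"
proof (rule eq_vecI)
  fix i assume "i < dim_vec (stack t s (\<lambda>j. f j + g j))"
  then have i: "i < t * s" by simp
  have "dim_vec (g (i div s)) = s" using assms(2)[of "i div s"] tensor_index_bounds[OF i] by simp
  then show "(stack t s f + stack t s g) $ i = stack t s (\<lambda>j. f j + g j) $ i"
    using i tensor_index_bounds[OF i] by (simp add: stack_def)
qed simp

text \<open>Both summands of \<open>ctrl_ge\<close> are diagonal on the clock with entries 0 and 1,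
  and in each block exactly one of them is active.\<close>

lemma ctrl_ge_stack:
  assumes "V \<in> carrier_mat s s" "\<And>j. j < t \<Longrightarrow> f j \<in> carrier_vec s"
  shows "ctrl_ge t s k V *\<^sub>v stack t s f = stack t s (\<lambda>j. if k \<le> j then V *\<^sub>v f j else f j)"
proof -
  have P: "proj_ge t k \<in> carrier_mat t t" by (simp add: proj_ge_def)
  have P': "1\<^sub>m t - proj_ge t k \<in> carrier_mat t t" using P by (rule minus_carrier_mat)
  have 1: "((1\<^sub>m t - proj_ge t k) \<otimes>\<^sub>m 1\<^sub>m s) *\<^sub>v stack t s f =
      stack t s (\<lambda>j. (1\<^sub>m t - proj_ge t k) $$ (j, j) \<cdot>\<^sub>v (1\<^sub>m s *\<^sub>v f j))"
    by (rule diag_tensor_stack[OF P' _ assms(2)]) (auto simp: proj_ge_def)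
  have 2: "(proj_ge t k \<otimes>\<^sub>m V) *\<^sub>v stack t s f =
      stack t s (\<lambda>j. proj_ge t k $$ (j, j) \<cdot>\<^sub>v (V *\<^sub>v f j))"
    by (rule diag_tensor_stack[OF P assms(1) assms(2)]) (auto simp: proj_ge_def)
  have "ctrl_ge t s k V *\<^sub>v stack t s f =
      ((1\<^sub>m t - proj_ge t k) \<otimes>\<^sub>m 1\<^sub>m s) *\<^sub>v stack t s f + (proj_ge t k \<otimes>\<^sub>m V) *\<^sub>v stack t s f"
    unfolding ctrl_ge_def using P P' assms(1)
    by (intro add_mult_distrib_mat_vec[where nr = "t * s" and nc = "t * s"]) auto
  also have "\<dots> = stack t s (\<lambda>j. (1\<^sub>m t - proj_ge t k) $$ (j, j) \<cdot>\<^sub>v (1\<^sub>m s *\<^sub>v f j)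
      + proj_ge t k $$ (j, j) \<cdot>\<^sub>v (V *\<^sub>v f j))"
    unfolding 1 2 using assms by (intro stack_add) auto
  also have "\<dots> = stack t s (\<lambda>j. if k \<le> j then V *\<^sub>v f j else f j)"
  proof (rule stack_cong)
    fix j assume j: "j < t"
    have d: "f j \<in> carrier_vec s" "V *\<^sub>v f j \<in> carrier_vec s" using assms j by auto
    then have "dim_vec (f j) = s" "dim_vec (V *\<^sub>v f j) = s" by (auto simp del: dim_mult_mat_vec)
    then show "(1\<^sub>m t - proj_ge t k) $$ (j, j) \<cdot>\<^sub>v (1\<^sub>m s *\<^sub>v f j) + proj_ge t k $$ (j, j) \<cdot>\<^sub>v (V *\<^sub>v f j) =
        (if k \<le> j then V *\<^sub>v f j else f j)"
      using j d by (intro eq_vecI) (auto simp: proj_ge_def simp del: dim_mult_mat_vec index_mult_mat_vec)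
  qed
  finally show ?thesis .
qed

lemma cscalar_prod_stack:
  assumes "\<And>j. j < t \<Longrightarrow> f j \<in> carrier_vec s" "\<And>j. j < t \<Longrightarrow> g j \<in> carrier_vec s"
  shows "stack t s f \<bullet>c stack t s g = (\<Sum>j<t. f j \<bullet>c g j)"
proof -
  have "stack t s f \<bullet>c stack t s g = (\<Sum>k<t * s. f (k div s) $ (k mod s) * cnj (g (k div s) $ (k mod s)))"
    by (simp add: cscalar_prod_sum stack_def)
  also have "\<dots> = (\<Sum>j<t. \<Sum>l<s. f j $ l * cnj (g j $ l))"
    by (rule sum_div_mod)
  also have "\<dots> = (\<Sum>j<t. f j \<bullet>c g j)"
  proof (rule sum.cong[OF refl])
    fix j assume "j \<in> {..<t}"
    then have "dim_vec (g j) = s" using assms(2)[of j] by simp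
    then show "(\<Sum>l<s. f j $ l * cnj (g j $ l)) = f j \<bullet>c g j" by (simp add: cscalar_prod_sum)
  qed
  finally show ?thesis .
qed

text \<open>The projection onto clock value \<open>y\<close> annihilates every other block, so the
  Born rule gives the squared norm of block \<open>y\<close>.\<close>

lemma outcome_prob_stack:
  assumes "\<And>j. j < t \<Longrightarrow> f j \<in> carrier_vec s" "y < t"
  shows "outcome_prob t s (stack t s f) y = Re (f y \<bullet>c f y)"
proof -
  let ?g = "\<lambda>j. ket_bra (unit_vec t y) $$ (j, j) \<cdot>\<^sub>v (1\<^sub>m s *\<^sub>v f j)"
  have "(ket_bra (unit_vec t y) \<otimes>\<^sub>m 1\<^sub>m s) *\<^sub>v stack t s f = stack t s ?g"
    by (rule diag_tensor_stack) (use assms in \<open>auto simp: ket_bra_def\<close>)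
  moreover have "stack t s ?g \<bullet>c stack t s ?g = (\<Sum>j<t. ?g j \<bullet>c ?g j)"
    using assms by (intro cscalar_prod_stack) auto
  moreover have "\<dots> = (\<Sum>j<t. if j = y then f y \<bullet>c f y else 0)"
  proof (rule sum.cong[OF refl])
    fix j assume "j \<in> {..<t}"
    then have "f j \<in> carrier_vec s" "j < t" using assms by auto
    then show "?g j \<bullet>c ?g j = (if j = y then f y \<bullet>c f y else 0)"
      using assms(2) by (auto simp: cscalar_prod_sum ket_bra_def)
  qed
  ultimately show ?thesis
    using assms by (simp add: outcome_prob_def Let_def)
qed

section \<open>Circuits that leave the clock untouched\<close>

lemma run_circuit_append:
  "run_circuit t m n Up Uq (c @ c') \<chi> = run_circuit t m n Up Uq c' (run_circuit t m n Up Uq c \<chi>)"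
  by (simp add: run_circuit_def)

lemma run_circuit_Nil [simp]: "run_circuit t m n Up Uq [] \<chi> = \<chi>"
  by (simp add: run_circuit_def)

lemma run_circuit_Cons:
  "run_circuit t m n Up Uq (g # c) \<chi> = run_circuit t m n Up Uq c (gate_op t m n Up Uq g *\<^sub>v \<chi>)"
  by (simp add: run_circuit_def)

text \<open>The interface between oracle circuits and the analysis of amplitude estimation. The
  inverse direction is recorded as well, because \<open>inverse_circuit\<close> is assembled gate by
  gate and every Grover step runs it.\<close>

definition implements ::
  "nat \<Rightarrow> nat \<Rightarrow> nat \<Rightarrow> complex mat \<Rightarrow> complex mat \<Rightarrow> nat \<Rightarrow> gate list \<Rightarrow> complex mat \<Rightarrow> bool" where
  "implements t m n Up Uq s c W \<longleftrightarrow> unitary_mat s W \<and>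
     (\<forall>\<chi>\<in>carrier_vec (t * s). run_circuit t m n Up Uq c \<chi> = (1\<^sub>m t \<otimes>\<^sub>m W) *\<^sub>v \<chi> \<and>
        run_circuit t m n Up Uq (inverse_circuit c) \<chi> = (1\<^sub>m t \<otimes>\<^sub>m mat_adjoint W) *\<^sub>v \<chi>)"

lemma implements_single:
  assumes "gate_op t m n Up Uq g = 1\<^sub>m t \<otimes>\<^sub>m W" "unitary_mat s W"
  shows "implements t m n Up Uq s [g] W"
  using assms by (simp add: implements_def run_circuit_Cons inverse_circuit_def tensor_mat_adjoint)

lemma implements_append:
  assumes "implements t m n Up Uq s c W" "implements t m n Up Uq s c' W'"
  shows "implements t m n Up Uq s (c @ c') (W' * W)"
proof -
  have U: "unitary_mat s W" "unitary_mat s W'" using assms by (auto simp: implements_def)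
  note W = unitary_matD[OF U(1)] unitary_matD[OF U(2)]
  have adj: "mat_adjoint (W' * W) = mat_adjoint W * mat_adjoint W'"
    using W by (intro mat_adjoint_mult) auto
  have tens: "1\<^sub>m t \<otimes>\<^sub>m (V * V') = (1\<^sub>m t \<otimes>\<^sub>m V) * (1\<^sub>m t \<otimes>\<^sub>m V')"
    if "V \<in> carrier_mat s s" "V' \<in> carrier_mat s s" for V V'
    using that by (simp add: tensor_mat_mult)
  have "(1\<^sub>m t \<otimes>\<^sub>m (V * V')) *\<^sub>v \<chi> = (1\<^sub>m t \<otimes>\<^sub>m V) *\<^sub>v ((1\<^sub>m t \<otimes>\<^sub>m V') *\<^sub>v \<chi>)"
    if "V \<in> carrier_mat s s" "V' \<in> carrier_mat s s" "\<chi> \<in> carrier_vec (t * s)" for V V' \<chi>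
    unfolding tens[OF that(1,2)] using that
    by (intro assoc_mult_mat_vec[where n\<^sub>1 = "t * s" and n\<^sub>2 = "t * s" and n\<^sub>3 = "t * s"]) auto
  moreover have "(1\<^sub>m t \<otimes>\<^sub>m V) *\<^sub>v \<chi> \<in> carrier_vec (t * s)" if "V \<in> carrier_mat s s" for V \<chi>
    using that by (intro carrier_vecI) simp
  ultimately show ?thesis
    using assms U W unfolding implements_def adj
    by (auto simp: run_circuit_append inverse_circuit_def unitary_mat_mult)
qed

lemma implements_stack:
  assumes "implements t m n Up Uq s c W" "\<And>j. j < t \<Longrightarrow> f j \<in> carrier_vec s"
  shows "run_circuit t m n Up Uq c (stack t s f) = stack t s (\<lambda>j. W *\<^sub>v f j)"
    "run_circuit t m n Up Uq (inverse_circuit c) (stack t s f) = stack t s (\<lambda>j. mat_adjoint W *\<^sub>v f j)"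
proof -
  have "W \<in> carrier_mat s s" using assms(1) by (auto simp: implements_def dest: unitary_matD)
  then show "run_circuit t m n Up Uq c (stack t s f) = stack t s (\<lambda>j. W *\<^sub>v f j)"
    "run_circuit t m n Up Uq (inverse_circuit c) (stack t s f) = stack t s (\<lambda>j. mat_adjoint W *\<^sub>v f j)"
    using assms by (simp_all add: implements_def one_tensor_stack)
qed

section \<open>The Fejer kernel\<close>

text \<open>This is the parallelogram law: with C and S the cosine and sine sums, the two sums on
  the right are C + iS and C - iS.\<close>

lemma cmod_sum_sin_cos:
  fixes e :: "nat \<Rightarrow> complex" and \<phi> :: "nat \<Rightarrow> real"
  shows "(cmod (\<Sum>j<t. e j * complex_of_real (sin (\<phi> j))))\<^sup>2 + (cmod (\<Sum>j<t. e j * complex_of_real (cos (\<phi> j))))\<^sup>2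
    = ((cmod (\<Sum>j<t. e j * cis (\<phi> j)))\<^sup>2 + (cmod (\<Sum>j<t. e j * cis (- \<phi> j)))\<^sup>2) / 2"
proof -
  let ?S = "\<Sum>j<t. e j * complex_of_real (sin (\<phi> j))"
  let ?C = "\<Sum>j<t. e j * complex_of_real (cos (\<phi> j))"
  have 1: "(\<Sum>j<t. e j * cis (\<phi> j)) = ?C + \<i> * ?S"
    unfolding sum_distrib_left sum.distrib[symmetric]
    by (rule sum.cong) (auto simp: complex_eq_iff algebra_simps)
  have 2: "(\<Sum>j<t. e j * cis (- \<phi> j)) = ?C - \<i> * ?S"
    unfolding sum_distrib_left sum_subtractf[symmetric]
    by (rule sum.cong) (auto simp: complex_eq_iff algebra_simps)
  show ?thesis
    unfolding 1 2 cmod_power2 by (simp add: power2_eq_square algebra_simps)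
qed

definition fejer :: "nat \<Rightarrow> real \<Rightarrow> real" where
  "fejer t \<alpha> = (cmod (\<Sum>j<t. cis (real j * \<alpha>)))\<^sup>2 / (real t)\<^sup>2"

lemma fejer_nonneg [simp]: "0 \<le> fejer t \<alpha>"
  by (simp add: fejer_def)

lemma fejer_minus [simp]: "fejer t (- \<alpha>) = fejer t \<alpha>"
proof -
  have "(\<Sum>j<t. cis (real j * - \<alpha>)) = cnj (\<Sum>j<t. cis (real j * \<alpha>))"
    by (simp add: cis_cnj)
  then show ?thesis by (simp only: fejer_def complex_mod_cnj)
qed

text \<open>The frequencies are integers. This period is what later identifies outcome
  \<open>t - y\<close> of one kernel with outcome \<open>y\<close> of the other.\<close>

lemma fejer_two_pi: "fejer t (\<alpha> + 2 * pi) = fejer t \<alpha>"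
proof -
  have "cis (real j * (\<alpha> + 2 * pi)) = cis (real j * \<alpha>)" for j
  proof -
    have "cis (real j * (\<alpha> + 2 * pi)) = cis (real j * \<alpha>) * cis (2 * pi) ^ j"
      by (simp add: cis_mult Complex.DeMoivre algebra_simps)
    then show ?thesis by simp
  qed
  then show ?thesis by (simp add: fejer_def)
qed

section \<open>Lower bound for the kernel at the two nearest outcomes\<close>

lemma sin_ge_cubic:
  fixes x :: real assumes "0 \<le> x" shows "x - x ^ 3 / 6 \<le> sin x"
proof -
  \<comment> \<open>Integrating sin z \<le> z once bounds the cosine, and integrating that bound
    gives the cubic. Integration is expressed as monotonicity of the difference, which vanishes at
    0.\<close>
  have c: "1 - y\<^sup>2 / 2 \<le> cos y" if "0 \<le> y" for y :: real
  proof -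
    have "cos 0 - (1 - 0\<^sup>2 / 2) \<le> cos y - (1 - y\<^sup>2 / 2)"
    proof (rule DERIV_nonneg_imp_nondecreasing[OF that])
      fix z :: real assume "0 \<le> z"
      then show "\<exists>d. ((\<lambda>y. cos y - (1 - y\<^sup>2 / 2)) has_real_derivative d) (at z) \<and> 0 \<le> d"
        using sin_x_le_x[of z] by (intro exI[of _ "z - sin z"]) (auto intro!: derivative_eq_intros)
    qed
    then show ?thesis by simp
  qed
  have "sin 0 - (0 - 0 ^ 3 / 6) \<le> sin x - (x - x ^ 3 / 6)"
  proof (rule DERIV_nonneg_imp_nondecreasing[OF assms])
    fix z :: real assume "0 \<le> z"
    then show "\<exists>d. ((\<lambda>y. sin y - (y - y ^ 3 / 6)) has_real_derivative d) (at z) \<and> 0 \<le> d"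
      using c[of z] by (intro exI[of _ "cos z - (1 - z\<^sup>2 / 2)"]) (auto intro!: derivative_eq_intros)
  qed
  then show ?thesis by simp
qed

text \<open>At y = pi/6 the sine is 1/2, so the cubic bound reads y (1 - y^2/6) \<le> 1/2. Any upper
  bound u of y then yields the better one 1/(2 (1 - u^2/6)). Starting from pi < 4, two rounds give
  2/3, 0.54, 0.5256, and 36 * 0.5256^2 is below 10.\<close>

lemma pi_squared_le_10: "pi\<^sup>2 \<le> 10"
proof -
  define y where "y = pi / 6"
  have y: "0 < y" "y \<le> 2/3" using pi_less_4 by (auto simp: y_def)
  have c: "y * (1 - y\<^sup>2 / 6) \<le> 1/2"
    using sin_ge_cubic[of y] y sin_30 by (simp add: y_def power2_eq_square power3_eq_cube algebra_simps)
  have step: "y * l \<le> 1/2" if "0 \<le> u" "y \<le> u" "l \<le> 1 - u\<^sup>2 / 6" for u l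
  proof -
    have "y\<^sup>2 \<le> u\<^sup>2" using that y by (intro power_mono) auto
    then have "l \<le> 1 - y\<^sup>2 / 6" using that by linarith
    then have "y * l \<le> y * (1 - y\<^sup>2 / 6)" using y by (intro mult_left_mono) auto
    then show ?thesis using c by linarith
  qed
  have "y \<le> 0.54" using step[of "2/3" "25/27"] y by (simp add: power2_eq_square)
  then have "y \<le> 0.5256" using step[of "0.54" "0.9514"] by (simp add: power2_eq_square)
  then have "y\<^sup>2 \<le> 0.5256\<^sup>2" using y by (intro power_mono) auto
  then show ?thesis by (simp add: y_def power2_eq_square)
qed

text \<open>This is \<open>sin\<^sup>2(\<pi>x) (1/(\<pi>x)\<^sup>2 + 1/(\<pi>(1 - x))\<^sup>2) \<ge> 2/3\<close> after \<open>sin z \<ge> z - z\<^sup>3/6\<close> and \<open>\<pi>\<^sup>2 \<le> 10\<close>.\<close>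

lemma two_neighbours_poly:
  fixes x :: real assumes "0 \<le> x" "x \<le> 1/2"
  shows "2/3 * (1 - x)\<^sup>2 \<le> (1 - 5 * x\<^sup>2 / 3)\<^sup>2 * ((1 - x)\<^sup>2 + x\<^sup>2)"
proof -
  \<comment> \<open>The inequality is delicate at x = 1/2, where the two sides are 48/288 and
    49/288. It is therefore expanded around that point; the factor 1 - 5x^2/3 becomes
    \<open>L\<close>, which is affine in \<open>v\<close>.\<close>
  define u where "u = 1/2 - x"
  define v where "v = u - u\<^sup>2"
  have u: "0 \<le> u" "u \<le> 1/2" using assms by (auto simp: u_def)
  have v: "0 \<le> v" "v = u * (1 - u)" using u mult_left_mono[of u 1 u]
    by (auto simp: v_def power2_eq_square algebra_simps)
  have v2: "u\<^sup>2 / 4 \<le> v\<^sup>2"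
  proof -
    have "u * (1/2) \<le> v" unfolding v(2) using u by (intro mult_left_mono) auto
    then have "(u * (1/2))\<^sup>2 \<le> v\<^sup>2" using u by (intro power_mono) auto
    then show ?thesis by (simp add: power2_eq_square)
  qed
  define L where "L = 7/12 + 5/3 * v"
  have L2: "L\<^sup>2 = 49/144 + 35/18 * v + 25/9 * v\<^sup>2" by (simp add: L_def power2_eq_square algebra_simps)
  have "49/144 * u\<^sup>2 \<le> L\<^sup>2 * u\<^sup>2" using v by (intro mult_right_mono) (auto simp: L2)
  moreover have "0 \<le> u * (1 - 2 * u)" using u by simp
  then have "2 * u\<^sup>2 \<le> u" by (simp add: power2_eq_square algebra_simps)
  ultimately have "2/3 * (1/4 + u + u\<^sup>2) \<le> (49/144 + 35/18 * v + 25/9 * v\<^sup>2) / 2 + 2 * (L\<^sup>2 * u\<^sup>2)"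
  proof -
    \<comment> \<open>With the nonlinear terms replaced by the independent variables
      \<open>U\<close>, \<open>V\<close> and \<open>M\<close>, the claim is a consequence of linear
      arithmetic.\<close>
    have "2/3 * (1/4 + u + U) \<le> (49/144 + 35/18 * v + 25/9 * V) / 2 + 2 * M"
      if "49/144 * U \<le> M" "2 * U \<le> u" "U / 4 \<le> V" "v = u - U" for U V M
      using that by argo
    then show ?thesis
      using v2 v_def \<open>49/144 * u\<^sup>2 \<le> L\<^sup>2 * u\<^sup>2\<close> \<open>2 * u\<^sup>2 \<le> u\<close> by blast
  qed
  then have "2/3 * (1/4 + u + u\<^sup>2) \<le> L\<^sup>2 / 2 + 2 * (L\<^sup>2 * u\<^sup>2)"
    by (simp only: L2)
  moreover have "x = 1/2 - u" by (simp add: u_def)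
  moreover have "1 - 5 * (1/2 - u)\<^sup>2 / 3 = L" by (simp add: L_def v_def power2_eq_square field_simps)
  moreover have "(1 - (1/2 - u))\<^sup>2 = 1/4 + u + u\<^sup>2" by (simp add: power2_eq_square algebra_simps)
  moreover have "L\<^sup>2 * (1/4 + u + u\<^sup>2 + (1/2 - u)\<^sup>2) = L\<^sup>2 / 2 + 2 * (L\<^sup>2 * u\<^sup>2)"
    by (simp add: power2_eq_square algebra_simps)
  ultimately show ?thesis by simp
qed

lemma fejer_zero: "0 < t \<Longrightarrow> fejer t 0 = 1"
  by (simp add: fejer_def)

lemma cmod_cis_minus_1: "cmod (cis x - 1) = 2 * \<bar>sin (x / 2)\<bar>"
proof -
  have "cos x = 1 - 2 * (sin (x / 2))\<^sup>2" using cos_double_sin[of "x / 2"] by simp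
  moreover have "(sin x)\<^sup>2 = 1 - (cos x)\<^sup>2" by (rule sin_squared_eq)
  ultimately have "(cmod (cis x - 1))\<^sup>2 = (2 * \<bar>sin (x / 2)\<bar>)\<^sup>2"
    unfolding cmod_power2 by (simp add: power2_eq_square algebra_simps)
  then show ?thesis by (rule power2_eq_imp_eq) auto
qed

text \<open>The geometric sum expresses the kernel through two chords of the unit circle, that is,
  through sin(pi \<delta>) and sin(pi \<delta>/t). Bounding the second sine by its argument makes t
  cancel.\<close>

lemma fejer_ge:
  assumes "0 < t" "\<delta> \<noteq> 0"
  shows "(sin (pi * \<delta>))\<^sup>2 / (pi * \<delta>)\<^sup>2 \<le> fejer t (2 * pi * \<delta> / real t)"
proof -
  define \<alpha> where "\<alpha> = 2 * pi * \<delta> / real t"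
  define D where "D = (\<Sum>j<t. cis (real j * \<alpha>))"
  have \<alpha>: "\<alpha> \<noteq> 0" using assms by (simp add: \<alpha>_def)
  have D': "D = (\<Sum>j<t. cis \<alpha> ^ j)" by (simp add: D_def Complex.DeMoivre)
  have "(cis \<alpha> - 1) * D = cis (real t * \<alpha>) - 1"
    unfolding D' power_diff_1_eq[symmetric] by (simp add: Complex.DeMoivre)
  then have "cmod (cis \<alpha> - 1) * cmod D = cmod (cis (real t * \<alpha>) - 1)"
    by (metis norm_mult)
  then have "\<bar>sin (pi * \<delta>)\<bar> = \<bar>sin (\<alpha> / 2)\<bar> * cmod D"
    unfolding cmod_cis_minus_1 using assms by (simp add: \<alpha>_def)
  also have "\<dots> \<le> \<bar>\<alpha> / 2\<bar> * cmod D"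
    by (intro mult_right_mono abs_sin_x_le_abs_x) auto
  finally have "\<bar>sin (pi * \<delta>)\<bar> / \<bar>pi * \<delta>\<bar> \<le> cmod D / real t"
    using assms by (simp add: \<alpha>_def field_simps abs_mult)
  then have "(\<bar>sin (pi * \<delta>)\<bar> / \<bar>pi * \<delta>\<bar>)\<^sup>2 \<le> (cmod D / real t)\<^sup>2"
    by (intro power_mono) auto
  then show ?thesis
    unfolding fejer_def \<alpha>_def[symmetric] D_def[symmetric] by (simp add: power_divide)
qed

text \<open>Here x and 1 - x are the distances from the angle to its two neighbours on the grid of
  outcomes. Both lower bounds have the same numerator, since sin(pi x) = sin(pi (1 - x)). The cubic
  bound for this numerator is good for x \<le> 1/2, and pi^2/6 \<le> 10/6 produces the 5/3 in
  \<open>L\<close>.\<close>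

lemma fejer_neighbours_half:
  assumes t: "0 < t" and x: "0 < x" "x \<le> 1/2"
  shows "2/3 \<le> fejer t (2 * pi * x / real t) + fejer t (2 * pi * (1 - x) / real t)"
proof -
  define L where "L = 1 - 5 * x\<^sup>2 / 3"
  have x2: "x\<^sup>2 \<le> (1/2)\<^sup>2" using x by (intro power_mono) auto
  then have L: "0 \<le> L" by (simp add: L_def power2_eq_square)
  have "pi\<^sup>2 * x\<^sup>2 \<le> 10 * x\<^sup>2" by (intro mult_right_mono pi_squared_le_10) auto
  then have "pi * x * L \<le> pi * x * (1 - (pi * x)\<^sup>2 / 6)"
    using x by (intro mult_left_mono) (auto simp: L_def power_mult_distrib)
  also have "\<dots> = pi * x - (pi * x) ^ 3 / 6"
    by (simp add: power2_eq_square power3_eq_cube algebra_simps)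
  also have "\<dots> \<le> sin (pi * x)" using x by (intro sin_ge_cubic) auto
  finally have "(pi * x * L)\<^sup>2 \<le> (sin (pi * x))\<^sup>2" using x L by (intro power_mono) auto
  note s = this
  have "sin (pi * (1 - x)) = sin (pi * x)" by (simp add: algebra_simps sin_diff)
  then have "(sin (pi * x))\<^sup>2 / (pi * x)\<^sup>2 + (sin (pi * x))\<^sup>2 / (pi * (1 - x))\<^sup>2
      \<le> fejer t (2 * pi * x / real t) + fejer t (2 * pi * (1 - x) / real t)"
    using fejer_ge[OF t, of x] fejer_ge[OF t, of "1 - x"] x by simp
  moreover have "(pi * x * L)\<^sup>2 / (pi * x)\<^sup>2 + (pi * x * L)\<^sup>2 / (pi * (1 - x))\<^sup>2
      \<le> (sin (pi * x))\<^sup>2 / (pi * x)\<^sup>2 + (sin (pi * x))\<^sup>2 / (pi * (1 - x))\<^sup>2"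
    using s by (intro add_mono divide_right_mono) auto
  moreover have "(pi * x * L)\<^sup>2 / (pi * x)\<^sup>2 = L\<^sup>2" "(pi * x * L)\<^sup>2 / (pi * (1 - x))\<^sup>2 = L\<^sup>2 * x\<^sup>2 / (1 - x)\<^sup>2"
    using x by (simp_all add: power_mult_distrib)
  moreover have "2/3 \<le> L\<^sup>2 + L\<^sup>2 * x\<^sup>2 / (1 - x)\<^sup>2"
  proof -
    have "0 < (1 - x)\<^sup>2" using x by simp
    moreover have "2/3 * (1 - x)\<^sup>2 \<le> L\<^sup>2 * ((1 - x)\<^sup>2 + x\<^sup>2)"
      unfolding L_def using x by (intro two_neighbours_poly) auto
    ultimately have "2/3 \<le> L\<^sup>2 * ((1 - x)\<^sup>2 + x\<^sup>2) / (1 - x)\<^sup>2" by (simp add: pos_le_divide_eq)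
    also have "\<dots> = L\<^sup>2 + L\<^sup>2 * x\<^sup>2 / (1 - x)\<^sup>2"
      using x by (simp add: distrib_left add_divide_distrib)
    finally show ?thesis .
  qed
  ultimately show ?thesis by linarith
qed

lemma fejer_neighbours:
  assumes t: "0 < t" and x: "0 \<le> x" "x < 1"
  shows "2/3 \<le> fejer t (2 * pi * x / real t) + fejer t (2 * pi * (1 - x) / real t)"
proof -
  consider "x = 0" | "0 < x" "x \<le> 1/2" | "0 < 1 - x" "1 - x \<le> 1/2" using x by linarith
  then show ?thesis
  proof cases
    case 1
    have "0 \<le> fejer t (2 * pi * (1 - x) / real t)" by (simp add: fejer_def)
    then show ?thesis using fejer_zero[OF t] 1 by simp
  next
    case 2 then show ?thesis by (rule fejer_neighbours_half[OF t])
  next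
    case 3 then show ?thesis using fejer_neighbours_half[OF t, of "1 - x"] by simp
  qed
qed

text \<open>The sine is 1-Lipschitz. The absolute values make the estimate insensitive to the sign
  of the angle, so that distances of angles carry over to the estimates of the amplitude.\<close>

lemma sin_diff_le: "\<bar>\<bar>sin x\<bar> - \<bar>sin y\<bar>\<bar> \<le> \<bar>x - y\<bar>" for x y :: real
proof -
  have "\<bar>sin x - sin y\<bar> = 2 * (\<bar>sin ((x - y) / 2)\<bar> * \<bar>cos ((x + y) / 2)\<bar>)"
    by (simp add: sin_diff_sin abs_mult)
  also have "\<dots> \<le> 2 * (\<bar>(x - y) / 2\<bar> * 1)"
    by (intro mult_left_mono mult_mono abs_sin_x_le_abs_x) auto
  finally show ?thesis by simp
qed

section \<open>Amplitude estimation\<close>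

locale amp_est =
  fixes t m n s :: nat and Up Uq :: "complex mat" and \<psi> :: "complex vec"
    and P W :: "complex mat" and cU :: "gate list"
  assumes t_pos: "0 < t"
    and \<psi>: "unit_vector s \<psi>"
    and P: "P \<in> carrier_mat s s" "P * P = P" "mat_adjoint P = P"
    and impl: "implements t m n Up Uq s cU W"
begin

lemma W: "W \<in> carrier_mat s s" "mat_adjoint W * W = 1\<^sub>m s" "W * mat_adjoint W = 1\<^sub>m s" "unitary_mat s W"
  using impl by (auto simp: implements_def dest: unitary_matD)

lemma \<psi>_carrier [simp]: "\<psi> \<in> carrier_vec s" and \<psi>_norm: "\<psi> \<bullet>c \<psi> = 1"
  using \<psi> by (auto simp: unit_vector_def)

text \<open>Neither component is normalised: their squared norms are \<open>amp\<close> and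
  \<open>1 - amp\<close>, and one of them may vanish.\<close>

abbreviation good where "good \<equiv> P *\<^sub>v (W *\<^sub>v \<psi>)"
abbreviation bad where "bad \<equiv> W *\<^sub>v \<psi> - P *\<^sub>v (W *\<^sub>v \<psi>)"
abbreviation amp where "amp \<equiv> Re (good \<bullet>c good)"

definition grover :: "complex vec \<Rightarrow> complex vec" where
  "grover v = W *\<^sub>v ((2 \<cdot>\<^sub>m ket_bra \<psi> - 1\<^sub>m s) *\<^sub>v (mat_adjoint W *\<^sub>v ((1\<^sub>m s - 2 \<cdot>\<^sub>m P) *\<^sub>v v)))"

lemma state_carrier [simp]: "W *\<^sub>v \<psi> \<in> carrier_vec s"
  using W(1) by simp

lemma good_carrier [simp]: "good \<in> carrier_vec s"
  using P(1) by simp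

lemma bad_carrier [simp]: "bad \<in> carrier_vec s"
  using good_carrier by simp

lemma state_norm: "(W *\<^sub>v \<psi>) \<bullet>c (W *\<^sub>v \<psi>) = 1"
  using unitary_mat_cscalar_prod[OF W(4)] \<psi>_norm by simp

lemma good_state: "good \<bullet>c (W *\<^sub>v \<psi>) = good \<bullet>c good"
proof -
  have PP: "P *\<^sub>v good = good"
    using P by (simp flip: assoc_mult_mat_vec[of _ s s _ s])
  show ?thesis
    using cscalar_prod_adjoint[OF P(1) good_carrier state_carrier] P(3) PP by simp
qed

lemma cscalar_prod_self: "v \<bullet>c v = complex_of_real (Re (v \<bullet>c v))" for v :: "complex vec"
  by (simp add: cscalar_prod_sum complex_eq_iff)

text \<open>Everything follows from \<open>good_state\<close> by expanding \<open>bad\<close>; the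
  bound on \<open>amp\<close> is the nonnegativity of the squared norm of
  \<open>bad\<close>.\<close>

lemma amp_le_1: "amp \<le> 1"
  and bad_norm: "bad \<bullet>c bad = 1 - good \<bullet>c good"
  and good_bad: "good \<bullet>c bad = 0" and bad_good: "bad \<bullet>c good = 0"
  and bad_state: "bad \<bullet>c (W *\<^sub>v \<psi>) = 1 - good \<bullet>c good"
proof -
  have d: "dim_vec good = s" "dim_vec (W *\<^sub>v \<psi>) = s" by (simp_all only: carrier_vecD[OF good_carrier] carrier_vecD[OF state_carrier])
  have cj: "(W *\<^sub>v \<psi>) \<bullet>c good = cnj (good \<bullet>c (W *\<^sub>v \<psi>))"
    using d by (simp add: cscalar_prod_sum mult.commute)
  have r: "cnj (good \<bullet>c good) = good \<bullet>c good"
    using cscalar_prod_self[of good] by (metis complex_cnj_complex_of_real)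
  show gb: "good \<bullet>c bad = 0"
    using d good_state by (simp add: cscalar_prod_sum algebra_simps sum_subtractf)
  show "bad \<bullet>c good = 0"
    using d good_state cj r by (simp add: cscalar_prod_sum algebra_simps sum_subtractf)
  show bs: "bad \<bullet>c (W *\<^sub>v \<psi>) = 1 - good \<bullet>c good"
    using d good_state state_norm by (simp add: cscalar_prod_sum algebra_simps sum_subtractf)
  have "bad \<bullet>c bad = bad \<bullet>c (W *\<^sub>v \<psi>) - bad \<bullet>c good"
    using d by (simp add: cscalar_prod_sum algebra_simps sum_subtractf)
  then show bb: "bad \<bullet>c bad = 1 - good \<bullet>c good" using bs \<open>bad \<bullet>c good = 0\<close> by simp
  have nn: "0 \<le> Re (v \<bullet>c v)" for v :: "complex vec"
    unfolding cscalar_prod_sum Re_sum by (rule sum_nonneg) simp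
  show "amp \<le> 1" using nn[of bad] bb by simp
qed

lemma grover_carrier [simp]: "v \<in> carrier_vec s \<Longrightarrow> grover v \<in> carrier_vec s"
  using W(1) P(1) by (auto simp: grover_def intro!: mult_mat_vec_carrier minus_carrier_mat)

lemma one_minus_mult:
  assumes "A \<in> carrier_mat s s" "v \<in> carrier_vec s"
  shows "(1\<^sub>m s - 2 \<cdot>\<^sub>m A) *\<^sub>v v = v - (2::complex) \<cdot>\<^sub>v (A *\<^sub>v v)"
    and "(2 \<cdot>\<^sub>m A - 1\<^sub>m s) *\<^sub>v v = (2::complex) \<cdot>\<^sub>v (A *\<^sub>v v) - v"
proof -
  have s: "(2 \<cdot>\<^sub>m A) *\<^sub>v v = (2::complex) \<cdot>\<^sub>v (A *\<^sub>v v)"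
    using assms by (intro eq_vecI) auto
  have "2 \<cdot>\<^sub>m A \<in> carrier_mat s s" using assms(1) by simp
  then show "(1\<^sub>m s - 2 \<cdot>\<^sub>m A) *\<^sub>v v = v - (2::complex) \<cdot>\<^sub>v (A *\<^sub>v v)"
    "(2 \<cdot>\<^sub>m A - 1\<^sub>m s) *\<^sub>v v = (2::complex) \<cdot>\<^sub>v (A *\<^sub>v v) - v"
    using assms(2) s by (simp_all add: minus_mult_distrib_mat_vec[of _ s s])
qed

text \<open>Conjugating the reflection about \<psi> by \<open>W\<close> gives the reflection
  2|\<Psi>\<rangle>\<langle>\<Psi>| - I about \<Psi> = \<open>good + bad\<close>. The first
  reflection flips the sign of \<alpha>; the overlap of the result with \<Psi> is the bracket that
  occurs twice, and the second reflection adds twice this multiple of \<Psi> and negates the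
  vector.\<close>

lemma grover_comb:
  "grover (\<alpha> \<cdot>\<^sub>v good + \<beta> \<cdot>\<^sub>v bad) =
     (\<alpha> + 2 * (\<beta> * (1 - good \<bullet>c good) - \<alpha> * (good \<bullet>c good))) \<cdot>\<^sub>v good +
     (2 * (\<beta> * (1 - good \<bullet>c good) - \<alpha> * (good \<bullet>c good)) - \<beta>) \<cdot>\<^sub>v bad"
proof -
  let ?v = "\<alpha> \<cdot>\<^sub>v good + \<beta> \<cdot>\<^sub>v bad" and ?w = "- \<alpha> \<cdot>\<^sub>v good + \<beta> \<cdot>\<^sub>v bad"
  note d = carrier_vecD[OF good_carrier] carrier_vecD[OF state_carrier]
  note nosimp = dim_mult_mat_vec index_mult_mat_vec(1)
  have PP: "P *\<^sub>v good = good"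
    using P by (simp flip: assoc_mult_mat_vec[of _ s s _ s])
  have Pb: "P *\<^sub>v bad = 0\<^sub>v s"
    using P(1) PP by (subst mult_minus_distrib_mat_vec[of _ s s]) simp_all
  have "P *\<^sub>v ?v = \<alpha> \<cdot>\<^sub>v good + \<beta> \<cdot>\<^sub>v 0\<^sub>v s"
    using P(1) by (subst mult_add_distrib_mat_vec[of _ s s]; simp add: mult_mat_vec[of _ s s] PP Pb)
  then have Pv: "P *\<^sub>v ?v = \<alpha> \<cdot>\<^sub>v good"
    by (intro eq_vecI) (auto simp: d simp del: nosimp)
  have 1: "(1\<^sub>m s - 2 \<cdot>\<^sub>m P) *\<^sub>v ?v = ?w"
    using P(1) by (subst one_minus_mult) (auto simp: Pv d simp del: nosimp intro!: eq_vecI)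
  have wc: "?w \<in> carrier_vec s" by simp
  have Wwc: "mat_adjoint W *\<^sub>v ?w \<in> carrier_vec s"
    by (rule mult_mat_vec_carrier[OF mat_adjoint_carrier[OF W(1)] wc])
  have "(mat_adjoint W *\<^sub>v ?w) \<bullet>c \<psi> = ?w \<bullet>c (W *\<^sub>v \<psi>)"
    using cscalar_prod_adjoint[of "mat_adjoint W" s s ?w \<psi>] W(1) wc by simp
  also have "\<dots> = - \<alpha> * (good \<bullet>c (W *\<^sub>v \<psi>)) + \<beta> * (bad \<bullet>c (W *\<^sub>v \<psi>))"
    by (simp add: cscalar_prod_sum d algebra_simps sum.distrib sum_subtractf sum_negf sum_distrib_left
        del: nosimp)
  also have "\<dots> = \<beta> * (1 - good \<bullet>c good) - \<alpha> * (good \<bullet>c good)" (is "_ = ?c")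
    by (simp only: good_state bad_state) simp
  finally have kb: "ket_bra \<psi> *\<^sub>v (mat_adjoint W *\<^sub>v ?w) = ?c \<cdot>\<^sub>v \<psi>"
    by (subst ket_bra_mult_vec) (simp_all only: carrier_vecD[OF Wwc] carrier_vecD[OF \<psi>_carrier])
  have "grover ?v = W *\<^sub>v (2 \<cdot>\<^sub>v (?c \<cdot>\<^sub>v \<psi>) - mat_adjoint W *\<^sub>v ?w)"
    unfolding grover_def 1 kb[symmetric] using Wwc by (subst one_minus_mult(2)) auto
  also have "\<dots> = 2 \<cdot>\<^sub>v (?c \<cdot>\<^sub>v (W *\<^sub>v \<psi>)) - W *\<^sub>v (mat_adjoint W *\<^sub>v ?w)"
    using W(1) Wwc by (subst mult_minus_distrib_mat_vec[of _ s s]) (auto simp: mult_mat_vec[of _ s s])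
  also have "W *\<^sub>v (mat_adjoint W *\<^sub>v ?w) = ?w"
    using W wc by (simp flip: assoc_mult_mat_vec[of _ s s _ s])
  also have "2 \<cdot>\<^sub>v (?c \<cdot>\<^sub>v (W *\<^sub>v \<psi>)) - ?w = (\<alpha> + 2 * ?c) \<cdot>\<^sub>v good + (2 * ?c - \<beta>) \<cdot>\<^sub>v bad"
    by (intro eq_vecI) (auto simp: d algebra_simps simp del: nosimp)
  finally show ?thesis .
qed

text \<open>The coefficients would be sin((2j+1)\<theta>)/sin \<theta> and cos((2j+1)\<theta>)/cos
  \<theta>; stating them multiplied out avoids division by zero. They do not depend on
  \<open>c\<close>, so the amplitude of the clock passes through without a separate proof that
  \<open>grover\<close> is linear.\<close>

lemma grover_power:
  assumes \<theta>: "(sin \<theta>)\<^sup>2 = amp"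
  shows "\<exists>\<alpha> \<beta>. (\<forall>c. (grover ^^ j) (c \<cdot>\<^sub>v (W *\<^sub>v \<psi>)) =
      (c * complex_of_real \<alpha>) \<cdot>\<^sub>v good + (c * complex_of_real \<beta>) \<cdot>\<^sub>v bad) \<and>
    \<alpha> * sin \<theta> = sin ((2 * real j + 1) * \<theta>) \<and> \<beta> * cos \<theta> = cos ((2 * real j + 1) * \<theta>)"
proof (induction j)
  case 0
  note d = carrier_vecD[OF good_carrier] carrier_vecD[OF state_carrier]
  have "c \<cdot>\<^sub>v (W *\<^sub>v \<psi>) = (c * complex_of_real 1) \<cdot>\<^sub>v good + (c * complex_of_real 1) \<cdot>\<^sub>v bad" for c
    by (rule eq_vecI) (auto simp: d algebra_simps simp del: dim_mult_mat_vec index_mult_mat_vec(1))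
  then show ?case by (intro exI[of _ 1]) auto
next
  case (Suc j)
  then obtain \<alpha> \<beta> where IH: "\<And>c. (grover ^^ j) (c \<cdot>\<^sub>v (W *\<^sub>v \<psi>)) =
      (c * complex_of_real \<alpha>) \<cdot>\<^sub>v good + (c * complex_of_real \<beta>) \<cdot>\<^sub>v bad"
    and A: "\<alpha> * sin \<theta> = sin ((2 * real j + 1) * \<theta>)" and B: "\<beta> * cos \<theta> = cos ((2 * real j + 1) * \<theta>)"
    by blast
  define a where "a = amp"
  \<comment> \<open>The common increment of both coefficients. With a = sin^2 \<theta> and the
    induction hypothesis it equals 2 cos((2j+2)\<theta>), even when the coefficients themselves are
    not determined by the angle.\<close>
  define \<delta> where "\<delta> = 2 * (\<beta> * (1 - a) - \<alpha> * a)"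
  have gg: "good \<bullet>c good = complex_of_real a" unfolding a_def by (rule cscalar_prod_self)
  have \<theta>: "(sin \<theta>)\<^sup>2 = a" using \<theta> by (simp only: a_def)
  have cos2: "(cos \<theta>)\<^sup>2 = 1 - a" using \<theta> sin_cos_squared_add[of \<theta>] by linarith
  have \<delta>: "\<delta> = 2 * (cos ((2 * real j + 1) * \<theta>) * cos \<theta> - sin ((2 * real j + 1) * \<theta>) * sin \<theta>)"
    unfolding \<delta>_def cos2[symmetric] unfolding \<theta>[symmetric] A[symmetric] B[symmetric]
    by (simp add: power2_eq_square)
  have \<delta>2: "\<delta> = 2 * cos ((2 * real j + 1) * \<theta> + \<theta>)"
    unfolding \<delta> cos_add ..
  have "(grover ^^ Suc j) (c \<cdot>\<^sub>v (W *\<^sub>v \<psi>)) =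
      (c * complex_of_real (\<alpha> + \<delta>)) \<cdot>\<^sub>v good + (c * complex_of_real (\<delta> - \<beta>)) \<cdot>\<^sub>v bad" for c
  proof -
    have "c * complex_of_real \<alpha> + 2 * (c * complex_of_real \<beta> * (1 - complex_of_real a) -
        c * complex_of_real \<alpha> * complex_of_real a) = c * complex_of_real (\<alpha> + \<delta>)"
      "2 * (c * complex_of_real \<beta> * (1 - complex_of_real a) -
        c * complex_of_real \<alpha> * complex_of_real a) - c * complex_of_real \<beta> = c * complex_of_real (\<delta> - \<beta>)"
      by (simp_all add: \<delta>_def algebra_simps)
    then show ?thesis unfolding funpow.simps comp_def IH grover_comb gg by simp
  qed
  moreover have "(\<alpha> + \<delta>) * sin \<theta> = sin ((2 * real (Suc j) + 1) * \<theta>)"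
  proof -
    have "(\<alpha> + \<delta>) * sin \<theta> = sin ((2 * real j + 1) * \<theta>) + 2 * cos ((2 * real j + 1) * \<theta> + \<theta>) * sin \<theta>"
      using A by (simp add: \<delta>2 algebra_simps)
    \<comment> \<open>With x = (2j+2)\<theta> this is sin(x - \<theta>) + 2 cos x sin \<theta> =
      sin(x + \<theta>); the cosine case below is its analogue.\<close>
    also have "\<dots> = sin ((2 * real j + 1) * \<theta> + \<theta> + \<theta>)"
    proof -
      define x where "x = (2 * real j + 1) * \<theta> + \<theta>"
      have e: "(2 * real j + 1) * \<theta> = x - \<theta>" by (simp add: x_def)
      show ?thesis unfolding x_def[symmetric] e by (simp add: sin_add sin_diff)
    qed
    also have "(2 * real j + 1) * \<theta> + \<theta> + \<theta> = (2 * real (Suc j) + 1) * \<theta>" by (simp add: algebra_simps)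
    finally show ?thesis .
  qed
  moreover have "(\<delta> - \<beta>) * cos \<theta> = cos ((2 * real (Suc j) + 1) * \<theta>)"
  proof -
    have "(\<delta> - \<beta>) * cos \<theta> = 2 * cos ((2 * real j + 1) * \<theta> + \<theta>) * cos \<theta> - cos ((2 * real j + 1) * \<theta>)"
      using B by (simp add: \<delta>2 algebra_simps)
    also have "\<dots> = cos ((2 * real j + 1) * \<theta> + \<theta> + \<theta>)"
    proof -
      define x where "x = (2 * real j + 1) * \<theta> + \<theta>"
      have e: "(2 * real j + 1) * \<theta> = x - \<theta>" by (simp add: x_def)
      show ?thesis unfolding x_def[symmetric] e by (simp add: cos_add cos_diff)
    qed
    also have "(2 * real j + 1) * \<theta> + \<theta> + \<theta> = (2 * real (Suc j) + 1) * \<theta>" by (simp add: algebra_simps)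
    finally show ?thesis .
  qed
  ultimately show ?case by blast
qed

end

text \<open>For clock values below \<open>k\<close> both reflections are switched off, and what
  remains is \<open>W\<close> times its adjoint, which cancels.\<close>

lemma (in amp_est) run_grover_step:
  assumes "\<And>j. j < t \<Longrightarrow> f j \<in> carrier_vec s"
  shows "run_circuit t m n Up Uq ([Fixed (ctrl_ge t s k (1\<^sub>m s - 2 \<cdot>\<^sub>m P))] @ inverse_circuit cU @
      [Fixed (ctrl_ge t s k (2 \<cdot>\<^sub>m ket_bra \<psi> - 1\<^sub>m s))] @ cU) (stack t s f) =
    stack t s (\<lambda>j. if k \<le> j then grover (f j) else f j)"
proof -
  let ?R1 = "1\<^sub>m s - 2 \<cdot>\<^sub>m P" and ?R2 = "2 \<cdot>\<^sub>m ket_bra \<psi> - 1\<^sub>m s"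
  have R: "?R1 \<in> carrier_mat s s" "?R2 \<in> carrier_mat s s"
    using P(1) by (auto intro!: minus_carrier_mat)
  have W': "mat_adjoint W \<in> carrier_mat s s" using W(1) by simp
  define f1 where "f1 = (\<lambda>j. if k \<le> j then ?R1 *\<^sub>v f j else f j)"
  define f2 where "f2 = (\<lambda>j. mat_adjoint W *\<^sub>v f1 j)"
  define f3 where "f3 = (\<lambda>j. if k \<le> j then ?R2 *\<^sub>v f2 j else f2 j)"
  have f1: "\<And>j. j < t \<Longrightarrow> f1 j \<in> carrier_vec s"
    using assms R(1) by (auto simp: f1_def intro: mult_mat_vec_carrier)
  have f2: "\<And>j. j < t \<Longrightarrow> f2 j \<in> carrier_vec s"
    unfolding f2_def using f1 W' by (rule mult_mat_vec_carrier[rotated])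
  have f3: "\<And>j. j < t \<Longrightarrow> f3 j \<in> carrier_vec s"
    using f2 R(2) by (auto simp: f3_def intro: mult_mat_vec_carrier)
  have steps: "ctrl_ge t s k ?R1 *\<^sub>v stack t s f = stack t s f1"
    "run_circuit t m n Up Uq (inverse_circuit cU) (stack t s f1) = stack t s f2"
    "ctrl_ge t s k ?R2 *\<^sub>v stack t s f2 = stack t s f3"
    "run_circuit t m n Up Uq cU (stack t s f3) = stack t s (\<lambda>j. W *\<^sub>v f3 j)"
  proof -
    show "ctrl_ge t s k ?R1 *\<^sub>v stack t s f = stack t s f1"
      unfolding f1_def by (rule ctrl_ge_stack[OF R(1)]) (rule assms)
    show "run_circuit t m n Up Uq (inverse_circuit cU) (stack t s f1) = stack t s f2"
      unfolding f2_def by (rule implements_stack(2)[OF impl]) (rule f1)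
    show "ctrl_ge t s k ?R2 *\<^sub>v stack t s f2 = stack t s f3"
      unfolding f3_def by (rule ctrl_ge_stack[OF R(2)]) (rule f2)
    show "run_circuit t m n Up Uq cU (stack t s f3) = stack t s (\<lambda>j. W *\<^sub>v f3 j)"
      by (rule implements_stack(1)[OF impl]) (rule f3)
  qed
  have "run_circuit t m n Up Uq ([Fixed (ctrl_ge t s k ?R1)] @ inverse_circuit cU @
      [Fixed (ctrl_ge t s k ?R2)] @ cU) (stack t s f) = stack t s (\<lambda>j. W *\<^sub>v f3 j)"
    by (simp only: run_circuit_append run_circuit_Cons run_circuit_Nil gate_op.simps steps)
  also have "\<dots> = stack t s (\<lambda>j. if k \<le> j then grover (f j) else f j)"
  proof (rule stack_cong)
    fix j assume "j < t"
    then show "W *\<^sub>v f3 j = (if k \<le> j then grover (f j) else f j)"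
      using W W' assms[of j]
      by (simp add: f3_def f2_def f1_def grover_def flip: assoc_mult_mat_vec[of W s s "mat_adjoint W" s])
  qed
  finally show ?thesis .
qed

lemma (in amp_est) funpow_grover_carrier [simp]:
  "v \<in> carrier_vec s \<Longrightarrow> (grover ^^ j) v \<in> carrier_vec s"
  by (induction j) auto

text \<open>Round \<open>k\<close> reaches exactly the branches \<open>j\<close> with k \<le> j, so
  after rounds 1 to K branch \<open>j\<close> has been hit \<open>min j K\<close> times.\<close>

lemma (in amp_est) run_grover_steps:
  assumes "v \<in> carrier_vec s"
  shows "run_circuit t m n Up Uq (concat (map (\<lambda>k. [Fixed (ctrl_ge t s k (1\<^sub>m s - 2 \<cdot>\<^sub>m P))] @
      inverse_circuit cU @ [Fixed (ctrl_ge t s k (2 \<cdot>\<^sub>m ket_bra \<psi> - 1\<^sub>m s))] @ cU) [1..<Suc K]))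
      (stack t s (\<lambda>j. v)) = stack t s (\<lambda>j. (grover ^^ min j K) v)"
proof (induction K)
  case (Suc K)
  have "(\<lambda>j. if Suc K \<le> j then grover ((grover ^^ min j K) v) else (grover ^^ min j K) v) =
      (\<lambda>j. (grover ^^ min j (Suc K)) v)"
    by (intro ext) (auto simp: min_def not_less_eq_eq le_Suc_eq)
  moreover have "[1..<Suc (Suc K)] = [1..<Suc K] @ [Suc K]" by simp
  ultimately show ?case
    using run_grover_step[of "\<lambda>j. (grover ^^ min j K) v" "Suc K"] assms
    by (simp only: map_append concat_append run_circuit_append[of _ _ _ _ _ "concat _"] Suc.IH
        list.map concat.simps append_Nil2 funpow_grover_carrier)
qed simp

lemma (in amp_est) run_amp_est:
  "run_circuit t m n Up Uq (amp_est_circuit t s \<psi> P cU) (unit_vec t 0 \<otimes>\<^sub>v \<psi>) =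
    stack t s (\<lambda>y. vec s (\<lambda>i. \<Sum>j<t. mat_adjoint (dft_mat t) $$ (y, j) *
      (grover ^^ j) (complex_of_real (1 / sqrt (real t)) \<cdot>\<^sub>v (W *\<^sub>v \<psi>)) $ i))"
proof -
  define c where "c = complex_of_real (1 / sqrt (real t))"
  have D: "dft_mat t \<in> carrier_mat t t" by (simp add: dft_mat_def)
  have "(dft_mat t \<otimes>\<^sub>m 1\<^sub>m s) *\<^sub>v (unit_vec t 0 \<otimes>\<^sub>v \<psi>) = (dft_mat t *\<^sub>v unit_vec t 0) \<otimes>\<^sub>v \<psi>"
    using D by (subst tensor_mat_mult_vec) (auto simp: carrier_vecD[OF \<psi>_carrier])
  also have "\<dots> = stack t s (\<lambda>j. (dft_mat t *\<^sub>v unit_vec t 0) $ j \<cdot>\<^sub>v \<psi>)"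
    using D by (intro tensor_vec_stack) auto
  \<comment> \<open>Column 0 of the Fourier matrix is constant, so the clock starts in the uniform
    superposition.\<close>
  also have "\<dots> = stack t s (\<lambda>j. c \<cdot>\<^sub>v \<psi>)"
    using D t_pos by (intro stack_cong) (auto simp: dft_mat_def c_def)
  finally have 1: "(dft_mat t \<otimes>\<^sub>m 1\<^sub>m s) *\<^sub>v (unit_vec t 0 \<otimes>\<^sub>v \<psi>) = stack t s (\<lambda>j. c \<cdot>\<^sub>v \<psi>)" .
  have "W *\<^sub>v (c \<cdot>\<^sub>v \<psi>) = c \<cdot>\<^sub>v (W *\<^sub>v \<psi>)"
    using W(1) by (intro mult_mat_vec) auto
  then have 2: "run_circuit t m n Up Uq cU (stack t s (\<lambda>j. c \<cdot>\<^sub>v \<psi>)) = stack t s (\<lambda>j. c \<cdot>\<^sub>v (W *\<^sub>v \<psi>))"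
    using implements_stack(1)[OF impl, of "\<lambda>j. c \<cdot>\<^sub>v \<psi>"] by simp
  \<comment> \<open>The rounds end at K = t - 1, the largest clock value, so the minimum in
    \<open>run_grover_steps\<close> is always \<open>j\<close>.\<close>
  have tm: "[1..<t] = [1..<Suc (t - 1)]" using t_pos by simp
  have v: "c \<cdot>\<^sub>v (W *\<^sub>v \<psi>) \<in> carrier_vec s" using state_carrier by (simp del: mult_mat_vec_carrier)
  have 3: "stack t s (\<lambda>j. (grover ^^ min j (t - 1)) (c \<cdot>\<^sub>v (W *\<^sub>v \<psi>))) =
      stack t s (\<lambda>j. (grover ^^ j) (c \<cdot>\<^sub>v (W *\<^sub>v \<psi>)))"
    by (rule stack_cong) (auto simp: min_def)
  have "run_circuit t m n Up Uq (amp_est_circuit t s \<psi> P cU) (unit_vec t 0 \<otimes>\<^sub>v \<psi>) =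
      (mat_adjoint (dft_mat t) \<otimes>\<^sub>m 1\<^sub>m s) *\<^sub>v stack t s (\<lambda>j. (grover ^^ j) (c \<cdot>\<^sub>v (W *\<^sub>v \<psi>)))"
    unfolding amp_est_circuit_def tm
    by (simp only: run_circuit_append[of _ _ _ _ _ "[_]"] run_circuit_append[of _ _ _ _ _ cU]
        run_circuit_append[of _ _ _ _ _ "concat _"]
        run_circuit_Cons run_circuit_Nil gate_op.simps 1 2 run_grover_steps[OF v] 3)
  also have "\<dots> = stack t s (\<lambda>y. vec s (\<lambda>i. \<Sum>j<t. mat_adjoint (dft_mat t) $$ (y, j) *
      (1\<^sub>m s *\<^sub>v (grover ^^ j) (c \<cdot>\<^sub>v (W *\<^sub>v \<psi>))) $ i))"
    using D v by (intro tensor_mat_stack) auto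
  finally show ?thesis
    using v by (simp add: c_def one_mult_mat_vec[OF funpow_grover_carrier[OF v]])
qed

text \<open>The block of outcome \<open>y\<close> is X \<open>good\<close> + Y \<open>bad\<close>
  with Fourier sums X and Y of the coefficients. Since the two vectors are orthogonal, the
  probability is |X|^2 \<open>amp\<close> + |Y|^2 (1 - \<open>amp\<close>).\<close>

lemma (in amp_est) outcome_prob_amp_est:
  assumes \<theta>: "(sin \<theta>)\<^sup>2 = amp" and y: "y < t"
  shows "outcome_prob t s (run_circuit t m n Up Uq (amp_est_circuit t s \<psi> P cU) (unit_vec t 0 \<otimes>\<^sub>v \<psi>)) y =
    (fejer t (2 * \<theta> - 2 * pi * real y / real t) + fejer t (2 * \<theta> + 2 * pi * real y / real t)) / 2"
proof -
  define c where "c = complex_of_real (1 / sqrt (real t))"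
  define a where "a = amp"
  define \<eta> where "\<eta> = 2 * pi * real y / real t"
  define e where "e = (\<lambda>j. cis (- (real j * \<eta>)) / complex_of_real (real t))"
  define \<phi> where "\<phi> = (\<lambda>j. (2 * real j + 1) * \<theta>)"
  obtain \<alpha> \<beta> where G: "\<And>j c. (grover ^^ j) (c \<cdot>\<^sub>v (W *\<^sub>v \<psi>)) =
      (c * complex_of_real (\<alpha> j)) \<cdot>\<^sub>v good + (c * complex_of_real (\<beta> j)) \<cdot>\<^sub>v bad"
    and \<alpha>: "\<And>j. \<alpha> j * sin \<theta> = sin (\<phi> j)" and \<beta>: "\<And>j. \<beta> j * cos \<theta> = cos (\<phi> j)"
    using grover_power[OF \<theta>] unfolding \<phi>_def by metis
  have D: "dft_mat t \<in> carrier_mat t t" by (simp add: dft_mat_def)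
  have De: "mat_adjoint (dft_mat t) $$ (y, j) * c = e j" if "j < t" for j
  proof -
    have "complex_of_real (sqrt (real t)) * complex_of_real (sqrt (real t)) = complex_of_real (real t)"
      by (simp flip: of_real_mult)
    then show ?thesis
      using that y t_pos by (simp add: dft_mat_def c_def e_def \<eta>_def cis_cnj mult_ac)
  qed
  define X where "X = (\<Sum>j<t. e j * complex_of_real (\<alpha> j))"
  define Y where "Y = (\<Sum>j<t. e j * complex_of_real (\<beta> j))"
  note d = carrier_vecD[OF good_carrier] carrier_vecD[OF bad_carrier] carrier_vecD[OF state_carrier]
  define g b where "g = good" and "b = bad"
  have dgb: "dim_vec g = s" "dim_vec b = s" unfolding g_def b_def by (rule d)+
  have "vec s (\<lambda>i. \<Sum>j<t. mat_adjoint (dft_mat t) $$ (y, j) * (grover ^^ j) (c \<cdot>\<^sub>v (W *\<^sub>v \<psi>)) $ i) =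
      X \<cdot>\<^sub>v g + Y \<cdot>\<^sub>v b" (is "?v = _")
  proof (rule eq_vecI)
    fix i assume "i < dim_vec (X \<cdot>\<^sub>v g + Y \<cdot>\<^sub>v b)"
    then have i: "i < s" by (simp add: dgb)
    have "?v $ i = (\<Sum>j<t. mat_adjoint (dft_mat t) $$ (y, j) *
        (c * complex_of_real (\<alpha> j) * g $ i + c * complex_of_real (\<beta> j) * b $ i))"
      using i unfolding G unfolding b_def[symmetric] unfolding g_def[symmetric] by (simp add: dgb)
    also have "\<dots> = (\<Sum>j<t. (mat_adjoint (dft_mat t) $$ (y, j) * c) *
        (complex_of_real (\<alpha> j) * g $ i + complex_of_real (\<beta> j) * b $ i))"
      by (simp add: algebra_simps)
    also have "\<dots> = (\<Sum>j<t. e j * (complex_of_real (\<alpha> j) * g $ i + complex_of_real (\<beta> j) * b $ i))"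
      by (rule sum.cong) (auto simp: De)
    also have "\<dots> = X * g $ i + Y * b $ i"
      by (simp add: X_def Y_def sum_distrib_left sum_distrib_right sum.distrib algebra_simps)
    finally show "?v $ i = (X \<cdot>\<^sub>v g + Y \<cdot>\<^sub>v b) $ i" using i by (simp add: dgb)
  qed (simp add: dgb)
  moreover have "(X \<cdot>\<^sub>v g + Y \<cdot>\<^sub>v b) \<bullet>c (X \<cdot>\<^sub>v g + Y \<cdot>\<^sub>v b) =
      X * cnj X * (g \<bullet>c g) + X * cnj Y * (g \<bullet>c b) + Y * cnj X * (b \<bullet>c g) + Y * cnj Y * (b \<bullet>c b)"
    by (simp add: cscalar_prod_sum dgb algebra_simps sum.distrib sum_distrib_left)
  moreover have "g \<bullet>c g = complex_of_real a" "g \<bullet>c b = 0" "b \<bullet>c g = 0" "b \<bullet>c b = complex_of_real (1 - a)"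
    using good_bad bad_good bad_norm cscalar_prod_self[of good] unfolding g_def b_def a_def
    by simp_all
  moreover have "X * cnj X = complex_of_real ((cmod X)\<^sup>2)" "Y * cnj Y = complex_of_real ((cmod Y)\<^sup>2)"
    by (rule complex_norm_square[symmetric])+
  ultimately have "outcome_prob t s (run_circuit t m n Up Uq (amp_est_circuit t s \<psi> P cU) (unit_vec t 0 \<otimes>\<^sub>v \<psi>)) y =
      (cmod X)\<^sup>2 * a + (cmod Y)\<^sup>2 * (1 - a)"
    unfolding run_amp_est c_def[symmetric] by (subst outcome_prob_stack[OF _ y]) simp_all
  \<comment> \<open>Absorbing sin \<theta> and cos \<theta> into the sums replaces the coefficients
    by sines and cosines of (2j+1)\<theta>, the only information that \<open>grover_power\<close>
    gives about them.\<close>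
  also have "\<dots> = (cmod (X * complex_of_real (sin \<theta>)))\<^sup>2 + (cmod (Y * complex_of_real (cos \<theta>)))\<^sup>2"
  proof -
    have "a = (sin \<theta>)\<^sup>2" "1 - a = (cos \<theta>)\<^sup>2"
      using \<theta> sin_cos_squared_add[of \<theta>] by (auto simp: a_def)
    then show ?thesis by (simp add: norm_mult power_mult_distrib)
  qed
  also have "X * complex_of_real (sin \<theta>) = (\<Sum>j<t. e j * complex_of_real (sin (\<phi> j)))"
    by (simp add: X_def sum_distrib_right mult.assoc \<alpha> flip: of_real_mult)
  also have "Y * complex_of_real (cos \<theta>) = (\<Sum>j<t. e j * complex_of_real (cos (\<phi> j)))"
    by (simp add: Y_def sum_distrib_right mult.assoc \<beta> flip: of_real_mult)
  also note cmod_sum_sin_cos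
  \<comment> \<open>The odd multiple 2j+1 splits into the frequency 2\<theta> and a phase cis
    \<theta> independent of j, which the modulus ignores.\<close>
  also have "(\<Sum>j<t. e j * cis (\<phi> j)) = cis \<theta> / complex_of_real (real t) * (\<Sum>j<t. cis (real j * (2 * \<theta> - \<eta>)))"
    by (simp add: sum_distrib_left e_def \<phi>_def cis_mult algebra_simps)
  also have "(\<Sum>j<t. e j * cis (- \<phi> j)) =
      cis (- \<theta>) / complex_of_real (real t) * (\<Sum>j<t. cis (real j * - (2 * \<theta> + \<eta>)))"
    by (simp add: sum_distrib_left e_def \<phi>_def cis_mult algebra_simps)
  also have "((cmod (cis \<theta> / complex_of_real (real t) * (\<Sum>j<t. cis (real j * (2 * \<theta> - \<eta>)))))\<^sup>2 +
      (cmod (cis (- \<theta>) / complex_of_real (real t) * (\<Sum>j<t. cis (real j * - (2 * \<theta> + \<eta>)))))\<^sup>2) / 2 =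
      (fejer t (2 * \<theta> - \<eta>) + fejer t (- (2 * \<theta> + \<eta>))) / 2"
    by (simp only: norm_mult norm_divide norm_cis norm_of_real fejer_def power_mult_distrib) (simp add: power_divide)
  finally show ?thesis by (simp only: fejer_minus \<eta>_def)
qed

text \<open>The first kernel concentrates near \<open>y = \<theta>t/\<pi>\<close>, the second one near \<open>t - y\<close> modulo \<open>t\<close>; both give
  the same estimate.\<close>

lemma (in amp_est) estimate_prob:
  assumes \<theta>: "(sin \<theta>)\<^sup>2 = amp" "0 \<le> \<theta>" "\<theta> \<le> pi / 2" and t: "3 \<le> t"
    and G: "G \<subseteq> {..<t}" "\<And>y. y < t \<Longrightarrow> \<bar>\<bar>sin (pi * real y / real t)\<bar> - \<bar>sin \<theta>\<bar>\<bar> \<le> pi / real t \<Longrightarrow> y \<in> G"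
  shows "2/3 \<le> (\<Sum>y\<in>G. outcome_prob t s (run_circuit t m n Up Uq (amp_est_circuit t s \<psi> P cU) (unit_vec t 0 \<otimes>\<^sub>v \<psi>)) y)"
proof -
  have tp: "0 < real t" using t by simp
  \<comment> \<open>The position of \<theta> in units of the grid spacing pi/t; \<open>k\<close> is
    its integer part and \<open>x\<close> its fractional part, so that \<open>k\<close> and
    \<open>k + 1\<close> are the neighbouring outcomes.\<close>
  define \<omega> where "\<omega> = \<theta> * real t / pi"
  define k where "k = nat \<lfloor>\<omega>\<rfloor>"
  define x where "x = \<omega> - real k"
  have \<omega>0: "0 \<le> \<omega>" using \<theta> tp by (simp add: \<omega>_def)
  have x: "0 \<le> x" "x < 1" using \<omega>0 unfolding x_def k_def by linarith+
  have \<theta>k: "\<theta> = pi * (real k + x) / real t" using tp by (simp add: x_def \<omega>_def)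
  have "\<omega> \<le> real t / 2"
  proof -
    have "\<theta> * real t \<le> pi / 2 * real t" using \<theta> by (intro mult_right_mono) auto
    then show ?thesis by (simp add: \<omega>_def field_simps)
  qed
  \<comment> \<open>Since \<omega> \<le> t/2, the right neighbour is at most t/2 + 1, which is below
    t because t \<ge> 3.\<close>
  then have k: "k + 1 < t" using x t unfolding x_def by linarith
  define near where "near = (\<lambda>y. \<bar>\<bar>sin (pi * real y / real t)\<bar> - \<bar>sin \<theta>\<bar>\<bar> \<le> pi / real t)"
  have near: "near k" "near (k + 1)"
  proof -
    have e: "pi * real k / real t - \<theta> = - (pi * x / real t)"
      "pi * real (k + 1) / real t - \<theta> = pi * (1 - x) / real t"
      using tp unfolding \<theta>k by (simp_all add: field_simps)
    have "0 \<le> pi * x / real t" "pi * x / real t \<le> pi / real t"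
      "0 \<le> pi * (1 - x) / real t" "pi * (1 - x) / real t \<le> pi / real t"
      using x tp by (auto intro: divide_right_mono)
    then show "near k" "near (k + 1)"
      unfolding near_def using sin_diff_le[of "pi * real k / real t" \<theta>, unfolded e]
        sin_diff_le[of "pi * real (k + 1) / real t" \<theta>, unfolded e]
      by linarith+
  qed
  have reflect: "pi * real (t - y) / real t = pi - pi * real y / real t" if "y \<le> t" for y
    using that tp by (simp add: of_nat_diff field_simps)
  have near_reflect: "near (t - y)" if "near y" "y \<le> t" for y
    using that by (simp add: near_def reflect del: of_nat_diff)
  let ?F = "\<lambda>y. fejer t (2 * \<theta> - 2 * pi * real y / real t)"
  let ?F' = "\<lambda>y. fejer t (2 * \<theta> + 2 * pi * real y / real t)"
  have F'_reflect: "?F' (t - y) = ?F y" if "y \<le> t" for y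
  proof -
    have "2 * \<theta> + 2 * pi * real (t - y) / real t = (2 * \<theta> - 2 * pi * real y / real t) + 2 * pi"
    proof -
      have "2 * pi * real (t - y) / real t = 2 * (pi * real (t - y) / real t)" by simp
      also have "\<dots> = 2 * pi - 2 * pi * real y / real t" unfolding reflect[OF that] by simp
      finally show ?thesis by simp
    qed
    then show ?thesis by (simp only: fejer_two_pi)
  qed
  have two: "2/3 \<le> ?F k + ?F (k + 1)"
  proof -
    have "2 * \<theta> - 2 * pi * real k / real t = 2 * pi * x / real t"
      "2 * \<theta> - 2 * pi * real (k + 1) / real t = - (2 * pi * (1 - x) / real t)"
      using tp unfolding \<theta>k by (simp_all add: field_simps)
    then show ?thesis using fejer_neighbours[OF t_pos x] by (simp only: fejer_minus)
  qed
  have fin: "finite G" using G(1) finite_subset by blast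
  have pair: "f a + f b \<le> sum f G" if "a \<in> G" "b \<in> G" "a \<noteq> b" "\<And>y. 0 \<le> f y" for f :: "nat \<Rightarrow> real" and a b
  proof -
    have "sum f {a, b} \<le> sum f G" using that fin by (intro sum_mono2) auto
    then show ?thesis using that by simp
  qed
  have in_G: "y \<in> G" if "near y" "y < t" for y using G(2) that by (simp add: near_def)
  have 1: "2/3 \<le> sum ?F G"
    using pair[of k "k + 1" ?F] in_G near k two by simp
  have 2: "2/3 \<le> sum ?F' G"
  \<comment> \<open>For k = 0 the mirror image t - k = t is not an outcome. Outcome 0 takes its
    place: there the two kernels coincide.\<close>
  proof (cases "k = 0")
    case True
    have "?F' 0 + ?F' (t - 1) \<le> sum ?F' G"
      using pair[of 0 "t - 1" ?F'] in_G near near_reflect[of 1] True k t by simp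
    then show ?thesis using two F'_reflect[of 1] True k by simp
  next
    case False
    have "?F' (t - k) + ?F' (t - (k + 1)) \<le> sum ?F' G"
      using False k near by (intro pair in_G near_reflect) auto
    then show ?thesis using two F'_reflect[of k] F'_reflect[of "k + 1"] k by simp
  qed
  have "(\<Sum>y\<in>G. outcome_prob t s (run_circuit t m n Up Uq (amp_est_circuit t s \<psi> P cU) (unit_vec t 0 \<otimes>\<^sub>v \<psi>)) y) =
      (\<Sum>y\<in>G. (?F y + ?F' y) / 2)"
    using G(1) by (intro sum.cong[OF refl] outcome_prob_amp_est[OF \<theta>(1)]) auto
  also have "\<dots> = (sum ?F G + sum ?F' G) / 2"
    by (simp only: sum_divide_distrib[symmetric] sum.distrib)
  also have "2/3 \<le> \<dots>"
  proof -
    have "2/3 \<le> (a + b) / 2" if "2/3 \<le> a" "2/3 \<le> b" for a b :: real using that by simp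
    then show ?thesis using 1 2 by blast
  qed
  finally show ?thesis .
qed

section \<open>The amplitude of the tested state\<close>

definition vec_sum :: "nat \<Rightarrow> nat \<Rightarrow> (nat \<Rightarrow> complex vec) \<Rightarrow> complex vec" where
  "vec_sum d n f = vec d (\<lambda>k. \<Sum>i<n. f i $ k)"

lemma vec_sum_carrier [simp]: "vec_sum d n f \<in> carrier_vec d"
  by (simp add: vec_sum_def)

lemma vec_sum_dim [simp]: "dim_vec (vec_sum d n f) = d"
  by (simp add: vec_sum_def)

lemma vec_sum_cong: "(\<And>i. i < n \<Longrightarrow> f i = g i) \<Longrightarrow> vec_sum d n f = vec_sum d n g"
  by (simp add: vec_sum_def)

text \<open>Replaces the sum in the oracle's definition by one whose entries are ordinary sums, so
  that linearity is an exchange of summations.\<close>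

lemma finsum_vec_eq_vec_sum:
  assumes "\<And>i. i < n \<Longrightarrow> f i \<in> carrier_vec d"
  shows "finsum_vec TYPE(complex) d f {..<n} = vec_sum d n f"
proof (rule eq_vecI)
  fix k assume "k < dim_vec (vec_sum d n f)"
  then show "finsum_vec TYPE(complex) d f {..<n} $ k = vec_sum d n f $ k"
    using assms by (simp add: vec_sum_def) (rule index_finsum_vec, auto)
next
  have "finsum_vec TYPE(complex) d f {..<n} \<in> carrier_vec d"
    by (rule finsum_vec_closed) (use assms in auto)
  then show "dim_vec (finsum_vec TYPE(complex) d f {..<n}) = dim_vec (vec_sum d n f)" by simp
qed

lemma mult_mat_vec_sum:
  assumes "A \<in> carrier_mat r d" "\<And>i. i < n \<Longrightarrow> f i \<in> carrier_vec d"
  shows "A *\<^sub>v vec_sum d n f = vec_sum r n (\<lambda>i. A *\<^sub>v f i)"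
proof (rule eq_vecI)
  fix k assume "k < dim_vec (vec_sum r n (\<lambda>i. A *\<^sub>v f i))"
  then have k: "k < r" by simp
  have "(A *\<^sub>v vec_sum d n f) $ k = (\<Sum>j<d. \<Sum>i<n. A $$ (k, j) * f i $ j)"
    using k assms(1) by (simp add: index_mult_mat_vec_sum vec_sum_def sum_distrib_left del: index_mult_mat_vec)
  also have "\<dots> = (\<Sum>i<n. \<Sum>j<d. A $$ (k, j) * f i $ j)" by (rule sum.swap)
  also have "\<dots> = (\<Sum>i<n. (A *\<^sub>v f i) $ k)"
  proof (rule sum.cong[OF refl])
    fix i assume "i \<in> {..<n}"
    then have "dim_vec (f i) = d" using assms(2) by auto
    then show "(\<Sum>j<d. A $$ (k, j) * f i $ j) = (A *\<^sub>v f i) $ k"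
      using k assms(1) by (simp add: index_mult_mat_vec_sum del: index_mult_mat_vec)
  qed
  finally show "(A *\<^sub>v vec_sum d n f) $ k = vec_sum r n (\<lambda>i. A *\<^sub>v f i) $ k" using k by (simp add: vec_sum_def)
qed (use assms in auto)

lemma tensor_vec_sum_left:
  assumes "\<And>i. i < n \<Longrightarrow> f i \<in> carrier_vec d"
  shows "vec_sum d n f \<otimes>\<^sub>v w = vec_sum (d * dim_vec w) n (\<lambda>i. f i \<otimes>\<^sub>v w)"
proof (rule eq_vecI)
  fix k assume "k < dim_vec (vec_sum (d * dim_vec w) n (\<lambda>i. f i \<otimes>\<^sub>v w))"
  then have k: "k < d * dim_vec w" by simp
  have "(f i \<otimes>\<^sub>v w) $ k = f i $ (k div dim_vec w) * w $ (k mod dim_vec w)" if "i < n" for i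
    using assms[OF that] k by simp
  then show "(vec_sum d n f \<otimes>\<^sub>v w) $ k = vec_sum (d * dim_vec w) n (\<lambda>i. f i \<otimes>\<^sub>v w) $ k"
    using k tensor_index_bounds[OF k] by (simp add: vec_sum_def sum_distrib_right)
qed simp

lemma cscalar_prod_vec_sum_right:
  assumes "\<And>i. i < n \<Longrightarrow> f i \<in> carrier_vec d"
  shows "v \<bullet>c vec_sum d n f = (\<Sum>i<n. v \<bullet>c f i)"
proof -
  have "v \<bullet>c vec_sum d n f = (\<Sum>k<d. \<Sum>i<n. v $ k * cnj (f i $ k))"
    by (simp add: cscalar_prod_sum vec_sum_def sum_distrib_left)
  also have "\<dots> = (\<Sum>i<n. \<Sum>k<d. v $ k * cnj (f i $ k))" by (rule sum.swap)
  also have "\<dots> = (\<Sum>i<n. v \<bullet>c f i)"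
  proof (rule sum.cong[OF refl])
    fix i assume "i \<in> {..<n}"
    then have "dim_vec (f i) = d" using assms[of i] by simp
    then show "(\<Sum>k<d. v $ k * cnj (f i $ k)) = v \<bullet>c f i" by (simp add: cscalar_prod_sum)
  qed
  finally show ?thesis .
qed

lemma ket_bra_tensor: "ket_bra u \<otimes>\<^sub>m ket_bra v = ket_bra (u \<otimes>\<^sub>v v)"
  by (rule eq_matI) (auto simp: ket_bra_def tensor_index_bounds)

lemma cscalar_prod_unit_vec:
  "i < n \<Longrightarrow> j < n \<Longrightarrow> unit_vec n i \<bullet>c unit_vec n j = (if i = j then 1 else 0 :: complex)"
  by (simp add: cscalar_prod_sum unit_vec_def if_distrib cong: if_cong)

text \<open>The operator \<open>tilde U\<close> of the algorithm on the systems A, B, C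
  alone.\<close>

definition copied :: "nat \<Rightarrow> nat \<Rightarrow> complex mat \<Rightarrow> complex mat \<Rightarrow> complex mat" where
  "copied m n V U = (mat_adjoint U \<otimes>\<^sub>m 1\<^sub>m n) * ((1\<^sub>m m \<otimes>\<^sub>m V) * (U \<otimes>\<^sub>m 1\<^sub>m n))"

text \<open>\<open>U\<close> creates the terms \<open>\<phi> i\<close> with |i\<rangle> and
  amplitude sqrt(p i), and the copy writes \<open>i\<close> into C. Projecting AB onto the reference
  state after undoing \<open>U\<close> is an overlap with the state that \<open>U\<close> created,
  so sqrt(p i) appears a second time and C carries p i.\<close>

lemma copied_overlap:
  assumes z: "unit_vector m zA" "unit_vector n zB" "unit_vector n zC"
    and p: "\<And>i. i < n \<Longrightarrow> 0 \<le> p i"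
    and U: "purified_access m n zA zB p U" and V: "copy_unitary n zC V"
  shows "(ket_bra zA \<otimes>\<^sub>m ket_bra zB \<otimes>\<^sub>m 1\<^sub>m n) *\<^sub>v (copied m n V U *\<^sub>v (zA \<otimes>\<^sub>v zB \<otimes>\<^sub>v zC)) =
    (zA \<otimes>\<^sub>v zB) \<otimes>\<^sub>v vec n (\<lambda>i. complex_of_real (p i))"
proof -
  define z where "z = zA \<otimes>\<^sub>v zB"
  have zs: "zA \<in> carrier_vec m" "zB \<in> carrier_vec n" "zC \<in> carrier_vec n"
    using z by (auto simp: unit_vector_def)
  have z': "z \<in> carrier_vec (m * n)" using zs by (simp add: z_def)
  have Uu: "unitary_mat (m * n) U" using U by (simp add: purified_access_def)
  note Uc = unitary_matD[OF Uu]
  have Vc: "V \<in> carrier_mat (n * n) (n * n)" using V by (auto simp: copy_unitary_def dest: unitary_matD)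
  obtain \<phi> where \<phi>: "\<And>i. i < n \<Longrightarrow> \<phi> i \<in> carrier_vec m"
    and orth: "\<And>i j. i < n \<Longrightarrow> j < n \<Longrightarrow> \<phi> j \<bullet>c \<phi> i = (if i = j then 1 else 0)"
    and Uz: "U *\<^sub>v z = finsum_vec TYPE(complex) (m * n)
              (\<lambda>i. complex_of_real (sqrt (p i)) \<cdot>\<^sub>v (\<phi> i \<otimes>\<^sub>v unit_vec n i)) {..<n}"
    using U unfolding purified_access_def z_def by blast
  define c where "c = (\<lambda>i. complex_of_real (sqrt (p i)))"
  define f where "f = (\<lambda>i. \<phi> i \<otimes>\<^sub>v unit_vec n i)"
  have f: "f i \<in> carrier_vec (m * n)" if "i < n" for i using \<phi>[OF that] by (simp add: f_def)
  have cf: "c i \<cdot>\<^sub>v f i \<in> carrier_vec (m * n)" if "i < n" for i using f[OF that] by simp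
  have Uz: "U *\<^sub>v z = vec_sum (m * n) n (\<lambda>i. c i \<cdot>\<^sub>v f i)"
    unfolding Uz using cf by (subst finsum_vec_eq_vec_sum) (auto simp: c_def f_def)
  let ?N = "m * n * n"
  have mats: "U \<otimes>\<^sub>m 1\<^sub>m n \<in> carrier_mat ?N ?N" "mat_adjoint U \<otimes>\<^sub>m 1\<^sub>m n \<in> carrier_mat ?N ?N"
    "ket_bra z \<otimes>\<^sub>m 1\<^sub>m n \<in> carrier_mat ?N ?N"
    using Uc(1) z' by simp_all
  have matV: "1\<^sub>m m \<otimes>\<^sub>m V \<in> carrier_mat ?N ?N"
    using tensor_mat_carrier[OF one_carrier_mat[of m] Vc] by (simp add: mult.assoc)
  have zc: "z \<otimes>\<^sub>v zC \<in> carrier_vec ?N" using z' zs by simp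
  have c1: "(U \<otimes>\<^sub>m 1\<^sub>m n) *\<^sub>v (z \<otimes>\<^sub>v zC) = vec_sum ?N n (\<lambda>i. (c i \<cdot>\<^sub>v f i) \<otimes>\<^sub>v zC)"
  proof -
    have "(U \<otimes>\<^sub>m 1\<^sub>m n) *\<^sub>v (z \<otimes>\<^sub>v zC) = (U *\<^sub>v z) \<otimes>\<^sub>v zC"
      using Uc(1) z' zs by (subst tensor_mat_mult_vec) (auto simp: carrier_vecD[OF z'] carrier_vecD[OF zs(3)])
    then show ?thesis
      unfolding Uz by (subst (asm) tensor_vec_sum_left) (simp_all add: f carrier_vecD[OF zs(3)])
  qed
  have c2: "(1\<^sub>m m \<otimes>\<^sub>m V) *\<^sub>v ((c i \<cdot>\<^sub>v f i) \<otimes>\<^sub>v zC) = (c i \<cdot>\<^sub>v f i) \<otimes>\<^sub>v unit_vec n i" if i: "i < n" for i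
  proof -
    have "(c i \<cdot>\<^sub>v f i) \<otimes>\<^sub>v zC = (c i \<cdot>\<^sub>v \<phi> i) \<otimes>\<^sub>v (unit_vec n i \<otimes>\<^sub>v zC)"
      by (simp add: f_def tensor_vec_smult_left tensor_vec_assoc)
    then have "(1\<^sub>m m \<otimes>\<^sub>m V) *\<^sub>v ((c i \<cdot>\<^sub>v f i) \<otimes>\<^sub>v zC) = (c i \<cdot>\<^sub>v \<phi> i) \<otimes>\<^sub>v (V *\<^sub>v (unit_vec n i \<otimes>\<^sub>v zC))"
    proof -
      have "c i \<cdot>\<^sub>v \<phi> i \<in> carrier_vec m" using \<phi>[OF i] by simp
      moreover have "(1\<^sub>m m \<otimes>\<^sub>m V) *\<^sub>v ((c i \<cdot>\<^sub>v \<phi> i) \<otimes>\<^sub>v (unit_vec n i \<otimes>\<^sub>v zC)) =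
          (1\<^sub>m m *\<^sub>v (c i \<cdot>\<^sub>v \<phi> i)) \<otimes>\<^sub>v (V *\<^sub>v (unit_vec n i \<otimes>\<^sub>v zC))"
        by (rule tensor_mat_mult_vec)
           (simp_all add: carrier_vecD[OF \<phi>[OF i]] carrier_vecD[OF zs(3)] carrier_matD[OF Vc])
      ultimately show ?thesis using \<open>_ = (c i \<cdot>\<^sub>v \<phi> i) \<otimes>\<^sub>v (unit_vec n i \<otimes>\<^sub>v zC)\<close>
        by (simp only: one_mult_mat_vec)
    qed
    also have "V *\<^sub>v (unit_vec n i \<otimes>\<^sub>v zC) = unit_vec n i \<otimes>\<^sub>v unit_vec n i"
      using V i by (simp add: copy_unitary_def)
    finally show ?thesis by (simp add: f_def tensor_vec_smult_left tensor_vec_assoc)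
  qed
  have c3: "(mat_adjoint U \<otimes>\<^sub>m 1\<^sub>m n) *\<^sub>v ((c i \<cdot>\<^sub>v f i) \<otimes>\<^sub>v unit_vec n i) =
      (mat_adjoint U *\<^sub>v (c i \<cdot>\<^sub>v f i)) \<otimes>\<^sub>v unit_vec n i" if i: "i < n" for i
    using Uc(1) f[OF i] by (subst tensor_mat_mult_vec) auto
  \<comment> \<open>The adjoint moves to the other side as \<open>U\<close> applied to
    \<open>z\<close>; orthonormality leaves only the term \<open>j = i\<close>, where the two square
    roots multiply to p i by nonnegativity.\<close>
  have in_U: "(mat_adjoint U *\<^sub>v (c i \<cdot>\<^sub>v f i)) \<bullet>c z = complex_of_real (p i)" if i: "i < n" for i
  proof -
    have "(mat_adjoint U *\<^sub>v (c i \<cdot>\<^sub>v f i)) \<bullet>c z = (c i \<cdot>\<^sub>v f i) \<bullet>c (U *\<^sub>v z)"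
      using cscalar_prod_adjoint[OF mat_adjoint_carrier[OF Uc(1)] cf[OF i] z'] by simp
    also have "\<dots> = (\<Sum>j<n. (c i \<cdot>\<^sub>v f i) \<bullet>c (c j \<cdot>\<^sub>v f j))"
      unfolding Uz using cf by (intro cscalar_prod_vec_sum_right) auto
    also have "\<dots> = (\<Sum>j<n. if j = i then complex_of_real (p i) else 0)"
    proof (rule sum.cong[OF refl])
      fix j assume "j \<in> {..<n}"
      then have j: "j < n" by simp
      have "(c i \<cdot>\<^sub>v f i) \<bullet>c (c j \<cdot>\<^sub>v f j) = c i * cnj (c j) * (f i \<bullet>c f j)"
        using f[OF i] f[OF j] by (simp add: cscalar_prod_sum sum_distrib_left mult_ac)
      also have "f i \<bullet>c f j = (if j = i then 1 else 0)"
        unfolding f_def using i j \<phi>[OF i] \<phi>[OF j] orth[OF j i]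
        by (subst tensor_cscalar_prod) (auto simp: cscalar_prod_unit_vec)
      also have "c i * cnj (c j) * (if j = i then 1 else 0) = (if j = i then complex_of_real (p i) else 0)"
        using p[OF i] by (auto simp: c_def simp flip: of_real_mult)
      finally show "(c i \<cdot>\<^sub>v f i) \<bullet>c (c j \<cdot>\<^sub>v f j) = (if j = i then complex_of_real (p i) else 0)" .
    qed
    finally show ?thesis using i by simp
  qed
  have c4: "(ket_bra z \<otimes>\<^sub>m 1\<^sub>m n) *\<^sub>v ((mat_adjoint U *\<^sub>v (c i \<cdot>\<^sub>v f i)) \<otimes>\<^sub>v unit_vec n i) =
      (complex_of_real (p i) \<cdot>\<^sub>v z) \<otimes>\<^sub>v unit_vec n i" if i: "i < n" for i
  proof -
    have "dim_vec (mat_adjoint U *\<^sub>v (c i \<cdot>\<^sub>v f i)) = dim_vec z" using Uc(1) by (simp add: carrier_vecD[OF z'])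
    then show ?thesis
      by (subst tensor_mat_mult_vec) (simp_all add: ket_bra_mult_vec in_U[OF i])
  qed
  have "copied m n V U *\<^sub>v (z \<otimes>\<^sub>v zC) =
      (mat_adjoint U \<otimes>\<^sub>m 1\<^sub>m n) *\<^sub>v ((1\<^sub>m m \<otimes>\<^sub>m V) *\<^sub>v ((U \<otimes>\<^sub>m 1\<^sub>m n) *\<^sub>v (z \<otimes>\<^sub>v zC)))"
    unfolding copied_def
    by (simp add: assoc_mult_mat_vec[OF mats(2) mult_carrier_mat[OF matV mats(1)] zc]
        assoc_mult_mat_vec[OF matV mats(1) zc])
  also have "\<dots> = vec_sum ?N n (\<lambda>i. (mat_adjoint U *\<^sub>v (c i \<cdot>\<^sub>v f i)) \<otimes>\<^sub>v unit_vec n i)" (is "_ = ?S")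
  proof -
    have 1: "(1\<^sub>m m \<otimes>\<^sub>m V) *\<^sub>v ((U \<otimes>\<^sub>m 1\<^sub>m n) *\<^sub>v (z \<otimes>\<^sub>v zC)) = vec_sum ?N n (\<lambda>i. (c i \<cdot>\<^sub>v f i) \<otimes>\<^sub>v unit_vec n i)"
      unfolding c1 using cf zs(3) by (subst mult_mat_vec_sum[OF matV]) (auto intro!: vec_sum_cong c2 tensor_vec_carrier)
    show ?thesis
      unfolding 1 using cf by (subst mult_mat_vec_sum[OF mats(2)]) (auto intro!: vec_sum_cong c3 tensor_vec_carrier)
  qed
  finally have c5: "copied m n V U *\<^sub>v (z \<otimes>\<^sub>v zC) = ?S" .
  have "(ket_bra z \<otimes>\<^sub>m 1\<^sub>m n) *\<^sub>v ?S = vec_sum ?N n (\<lambda>i. (complex_of_real (p i) \<cdot>\<^sub>v z) \<otimes>\<^sub>v unit_vec n i)"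
    by (subst mult_mat_vec_sum[OF mats(3)])
       (auto intro!: vec_sum_cong c4 tensor_vec_carrier mult_mat_vec_carrier[OF mat_adjoint_carrier[OF Uc(1)]] cf)
  also have "\<dots> = z \<otimes>\<^sub>v vec n (\<lambda>i. complex_of_real (p i))"
  proof (rule eq_vecI)
    fix k assume "k < dim_vec (z \<otimes>\<^sub>v vec n (\<lambda>i. complex_of_real (p i)))"
    then have k: "k < m * n * n" by (simp add: carrier_vecD[OF z'])
    note kb = tensor_index_bounds[OF k]
    have "(\<Sum>i<n. complex_of_real (p i) * z $ (k div n) * (if k mod n = i then 1 else 0)) =
        complex_of_real (p (k mod n)) * z $ (k div n)"
      using kb by (simp add: if_distrib cong: if_cong)
    then show "vec_sum ?N n (\<lambda>i. (complex_of_real (p i) \<cdot>\<^sub>v z) \<otimes>\<^sub>v unit_vec n i) $ k =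
        (z \<otimes>\<^sub>v vec n (\<lambda>i. complex_of_real (p i))) $ k"
      using k kb by (simp add: vec_sum_def carrier_vecD[OF z'] unit_vec_def mult.commute)
  qed (simp add: carrier_vecD[OF z'])
  finally show ?thesis
    unfolding c5[symmetric] unfolding z_def by (simp add: tensor_vec_assoc tensor_mat_assoc flip: ket_bra_tensor)
qed

section \<open>Operators controlled by the qubit D\<close>

abbreviation kb :: "nat \<Rightarrow> complex mat" where
  "kb b \<equiv> ket_bra (unit_vec 2 b)"

lemma ket_bra_mult:
  assumes "dim_vec u = d" "dim_vec v = d"
  shows "ket_bra u * ket_bra v = (v \<bullet>c u) \<cdot>\<^sub>m mat d d (\<lambda>(i, j). u $ i * cnj (v $ j))"
  by (rule eq_matI) (use assms in \<open>auto simp: ket_bra_def index_mult_mat_sum cscalar_prod_sum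
      sum_distrib_left sum_distrib_right mult_ac simp del: index_mult_mat(1)\<close>)

lemma ket_bra_unit_vec_mult:
  assumes "b < d" "c < d"
  shows "ket_bra (unit_vec d b) * ket_bra (unit_vec d c) = (if b = c then ket_bra (unit_vec d b) else 0\<^sub>m d d)"
  by (rule eq_matI) (use assms in \<open>auto simp: ket_bra_mult[of _ d] cscalar_prod_unit_vec\<close>,
      auto simp: ket_bra_def)

lemma kb_sum: "b < 2 \<Longrightarrow> kb b + kb (1 - b) = 1\<^sub>m 2"
  by (rule eq_matI) (auto simp: ket_bra_def less_2_cases_iff)

lemma unitary_hadamard: "unitary_mat 2 hadamard"
proof -
  have h: "complex_of_real (sqrt 2) * complex_of_real (sqrt 2) = 2"
    by (simp flip: of_real_mult)
  have "hadamard * mat_adjoint hadamard = 1\<^sub>m 2"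
    by (rule eq_matI) (auto simp: hadamard_def index_mult_mat_sum less_2_cases_iff h field_simps
        numeral_2_eq_2 simp del: index_mult_mat(1))
  moreover have "mat_adjoint hadamard = hadamard"
    by (rule eq_matI) (auto simp: hadamard_def)
  ultimately show ?thesis by (simp add: unitary_mat_def hadamard_def)
qed

lemma unitary_pauli_x: "unitary_mat 2 pauli_x"
proof -
  have "pauli_x * mat_adjoint pauli_x = 1\<^sub>m 2"
    by (rule eq_matI) (auto simp: pauli_x_def index_mult_mat_sum less_2_cases_iff
        numeral_2_eq_2 simp del: index_mult_mat(1))
  moreover have "mat_adjoint pauli_x = pauli_x"
    by (rule eq_matI) (auto simp: pauli_x_def)
  ultimately show ?thesis by (simp add: unitary_mat_def pauli_x_def)
qed

text \<open>D is the last tensor factor. For \<open>b < 2\<close> the value \<open>1 - b\<close> is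
  the other bit, on which the operator is the identity.\<close>

definition ctl :: "nat \<Rightarrow> complex mat \<Rightarrow> complex mat" where
  "ctl b X = X \<otimes>\<^sub>m kb b + 1\<^sub>m (dim_row X) \<otimes>\<^sub>m kb (1 - b)"

lemma ctl_carrier: "X \<in> carrier_mat N N \<Longrightarrow> ctl b X \<in> carrier_mat (N * 2) (N * 2)"
  by (simp add: ctl_def)

text \<open>The cross terms vanish because the two projectors on D are orthogonal. This lets a
  circuit be controlled gate by gate.\<close>

lemma ctl_mult:
  assumes X: "X \<in> carrier_mat N N" and Y: "Y \<in> carrier_mat N N" and b: "b < 2"
  shows "ctl b X * ctl b Y = ctl b (X * Y)"
proof -
  let ?M = "N * 2"
  define b' where "b' = 1 - b"
  have c: "X \<otimes>\<^sub>m kb b \<in> carrier_mat ?M ?M" "1\<^sub>m N \<otimes>\<^sub>m kb b' \<in> carrier_mat ?M ?M"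
    "Y \<otimes>\<^sub>m kb b \<in> carrier_mat ?M ?M" using X Y by simp_all
  have k: "kb b * kb b = kb b" "kb b' * kb b' = kb b'"
    "kb b * kb b' = 0\<^sub>m 2 2" "kb b' * kb b = 0\<^sub>m 2 2"
    using b by (auto simp: b'_def less_2_cases_iff ket_bra_unit_vec_mult)
  have "ctl b X * ctl b Y =
      ((X \<otimes>\<^sub>m kb b) * (Y \<otimes>\<^sub>m kb b) + (X \<otimes>\<^sub>m kb b) * (1\<^sub>m N \<otimes>\<^sub>m kb b')) +
      ((1\<^sub>m N \<otimes>\<^sub>m kb b') * (Y \<otimes>\<^sub>m kb b) + (1\<^sub>m N \<otimes>\<^sub>m kb b') * (1\<^sub>m N \<otimes>\<^sub>m kb b'))"
    unfolding ctl_def b'_def[symmetric] carrier_matD[OF X] carrier_matD[OF Y] using c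
    by (subst add_mult_distrib_mat[of _ ?M ?M _ _ ?M]; simp add: mult_add_distrib_mat[of _ ?M ?M _ ?M])
  also have "\<dots> = ctl b (X * Y)"
    unfolding ctl_def b'_def[symmetric] using X Y by (simp add: tensor_mat_mult k tensor_mat_zero_right)
  finally show ?thesis .
qed

lemma ctl_one: assumes "b < 2" shows "ctl b (1\<^sub>m N) = 1\<^sub>m (N * 2)"
proof -
  have "1\<^sub>m N \<otimes>\<^sub>m kb b + 1\<^sub>m N \<otimes>\<^sub>m kb (1 - b) = 1\<^sub>m N \<otimes>\<^sub>m (kb b + kb (1 - b))"
    by (rule tensor_mat_add_right[symmetric]) simp_all
  then show ?thesis by (simp only: ctl_def index_one_mat kb_sum[OF assms] tensor_mat_one)
qed

lemma ctl_adjoint: "X \<in> carrier_mat N N \<Longrightarrow> mat_adjoint (ctl b X) = ctl b (mat_adjoint X)"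
  by (simp add: ctl_def mat_adjoint_add tensor_mat_adjoint)

lemma unitary_ctl:
  assumes "unitary_mat N X" "b < 2" shows "unitary_mat (N * 2) (ctl b X)"
proof -
  note X = unitary_matD[OF assms(1)] and X' = mat_adjoint_carrier[OF unitary_matD(1)[OF assms(1)]]
  show ?thesis
    unfolding unitary_mat_def ctl_adjoint[OF X(1)] ctl_mult[OF X(1) X' assms(2)] ctl_mult[OF X' X(1) assms(2)] X(2,3)
    using ctl_carrier[OF X(1)] ctl_one[OF assms(2)] by simp
qed

lemma kb_mult_unit_vec: "b < 2 \<Longrightarrow> c < 2 \<Longrightarrow> kb b *\<^sub>v unit_vec 2 c = (if b = c then unit_vec 2 b else 0\<^sub>v 2)"
  by (subst ket_bra_mult_vec) (auto simp: cscalar_prod_unit_vec)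

lemma tensor_vec_zero_right: "u \<otimes>\<^sub>v 0\<^sub>v d = 0\<^sub>v (dim_vec u * d)"
  by (rule eq_vecI) (auto simp: tensor_index_bounds)

text \<open>A state given by its unnormalised branches for D = 0 and D = 1.\<close>

definition qpair :: "complex vec \<Rightarrow> complex vec \<Rightarrow> complex vec" where
  "qpair u v = u \<otimes>\<^sub>v unit_vec 2 0 + v \<otimes>\<^sub>v unit_vec 2 1"

lemma tensor_mult_qpair:
  assumes "X \<in> carrier_mat N N" "B \<in> carrier_mat 2 2" "u \<in> carrier_vec N" "v \<in> carrier_vec N"
  shows "(X \<otimes>\<^sub>m B) *\<^sub>v qpair u v = (X *\<^sub>v u) \<otimes>\<^sub>v (B *\<^sub>v unit_vec 2 0) + (X *\<^sub>v v) \<otimes>\<^sub>v (B *\<^sub>v unit_vec 2 1)"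
proof -
  have "X \<otimes>\<^sub>m B \<in> carrier_mat (N * 2) (N * 2)" using assms by simp
  then show ?thesis
    unfolding qpair_def using assms
    by (subst mult_add_distrib_mat_vec[of _ "N * 2" "N * 2"]) (simp_all add: tensor_mat_mult_vec)
qed

lemma proj_qpair:
  assumes "R \<in> carrier_mat N N" "u \<in> carrier_vec N" "v \<in> carrier_vec N"
  shows "(R \<otimes>\<^sub>m kb 0) *\<^sub>v qpair u v = (R *\<^sub>v u) \<otimes>\<^sub>v unit_vec 2 0"
    "(R \<otimes>\<^sub>m kb 1) *\<^sub>v qpair u v = (R *\<^sub>v v) \<otimes>\<^sub>v unit_vec 2 1"
proof -
  have "(R *\<^sub>v u) \<otimes>\<^sub>v unit_vec 2 0 \<in> carrier_vec (N * 2)" "(R *\<^sub>v v) \<otimes>\<^sub>v unit_vec 2 1 \<in> carrier_vec (N * 2)"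
    using assms by auto
  then show "(R \<otimes>\<^sub>m kb 0) *\<^sub>v qpair u v = (R *\<^sub>v u) \<otimes>\<^sub>v unit_vec 2 0"
    "(R \<otimes>\<^sub>m kb 1) *\<^sub>v qpair u v = (R *\<^sub>v v) \<otimes>\<^sub>v unit_vec 2 1"
    using assms by (subst tensor_mult_qpair[of _ N]; auto simp: kb_mult_unit_vec tensor_vec_zero_right)+
qed

lemma ctl_qpair:
  assumes "X \<in> carrier_mat N N" "u \<in> carrier_vec N" "v \<in> carrier_vec N"
  shows "ctl 0 X *\<^sub>v qpair u v = qpair (X *\<^sub>v u) v" "ctl 1 X *\<^sub>v qpair u v = qpair u (X *\<^sub>v v)"
proof -
  have c: "X \<otimes>\<^sub>m kb b \<in> carrier_mat (N * 2) (N * 2)" "1\<^sub>m N \<otimes>\<^sub>m kb b \<in> carrier_mat (N * 2) (N * 2)" for b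
    using assms by simp_all
  have q: "qpair u v \<in> carrier_vec (N * 2)" using assms by (simp add: qpair_def)
  have e: "ctl b X *\<^sub>v qpair u v = (X \<otimes>\<^sub>m kb b) *\<^sub>v qpair u v + (1\<^sub>m N \<otimes>\<^sub>m kb (1 - b)) *\<^sub>v qpair u v" for b
    unfolding ctl_def carrier_matD(1)[OF assms(1)] by (rule add_mult_distrib_mat_vec[OF c(1) c(2) q])
  have t: "x \<otimes>\<^sub>v unit_vec 2 i \<in> carrier_vec (N * 2)" if "x \<in> carrier_vec N" for x i
    using that by simp
  note p = proj_qpair[OF assms] proj_qpair[OF one_carrier_mat assms(2,3)]
    one_mult_mat_vec[OF assms(2)] one_mult_mat_vec[OF assms(3)]
  show "ctl 0 X *\<^sub>v qpair u v = qpair (X *\<^sub>v u) v"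
    unfolding e[of 0] diff_zero p unfolding qpair_def ..
  show "ctl 1 X *\<^sub>v qpair u v = qpair u (X *\<^sub>v v)"
    unfolding e[of 1] diff_self_eq_0 p unfolding qpair_def
    by (rule comm_add_vec[OF t t]) (use assms in auto)
qed

text \<open>The X gate sends |0\<rangle> to |1\<rangle> before the Hadamard gate acts. This gives
  branch 1 the minus sign because of which the final Hadamard gate yields p - q, not p + q, in
  branch 0.\<close>

lemma hadamard_pauli_x_tensor:
  assumes "z \<in> carrier_vec N"
  shows "(1\<^sub>m N \<otimes>\<^sub>m (hadamard * pauli_x)) *\<^sub>v (z \<otimes>\<^sub>v unit_vec 2 0) =
    qpair (complex_of_real (1 / sqrt 2) \<cdot>\<^sub>v z) (complex_of_real (- 1 / sqrt 2) \<cdot>\<^sub>v z)"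
proof -
  have m: "hadamard * pauli_x \<in> carrier_mat 2 2"
    by (rule unitary_matD(1)[OF unitary_mat_mult[OF unitary_hadamard unitary_pauli_x]])
  have 1: "(hadamard * pauli_x) *\<^sub>v unit_vec 2 0 =
      complex_of_real (1 / sqrt 2) \<cdot>\<^sub>v unit_vec 2 0 + complex_of_real (- 1 / sqrt 2) \<cdot>\<^sub>v unit_vec 2 1"
    by (rule eq_vecI) (auto simp: hadamard_def pauli_x_def index_mult_mat_vec_sum index_mult_mat_sum
        less_2_cases_iff numeral_2_eq_2 simp del: index_mult_mat_vec index_mult_mat(1))
  have "(1\<^sub>m N \<otimes>\<^sub>m (hadamard * pauli_x)) *\<^sub>v (z \<otimes>\<^sub>v unit_vec 2 0) = z \<otimes>\<^sub>v ((hadamard * pauli_x) *\<^sub>v unit_vec 2 0)"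
    using assms m by (subst tensor_mat_mult_vec) auto
  then show ?thesis
    unfolding 1 qpair_def by (simp add: tensor_vec_add_right tensor_vec_smult_left tensor_vec_smult_right)
qed

lemma hadamard_qpair:
  assumes "u \<in> carrier_vec N" "v \<in> carrier_vec N"
  shows "(1\<^sub>m N \<otimes>\<^sub>m hadamard) *\<^sub>v qpair u v =
    qpair (complex_of_real (1 / sqrt 2) \<cdot>\<^sub>v (u + v)) (complex_of_real (1 / sqrt 2) \<cdot>\<^sub>v (u - v))"
proof -
  have H: "hadamard *\<^sub>v unit_vec 2 0 = complex_of_real (1 / sqrt 2) \<cdot>\<^sub>v (unit_vec 2 0 + unit_vec 2 1)"
    "hadamard *\<^sub>v unit_vec 2 1 = complex_of_real (1 / sqrt 2) \<cdot>\<^sub>v (unit_vec 2 0 - unit_vec 2 1)"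
    by (rule eq_vecI, auto simp: hadamard_def less_2_cases_iff)+
  have m: "hadamard \<in> carrier_mat 2 2" by (simp add: hadamard_def)
  note d = carrier_vecD[OF assms(1)] carrier_vecD[OF assms(2)]
  show ?thesis
    unfolding tensor_mult_qpair[OF one_carrier_mat m assms] H
    by (rule eq_vecI)
       (auto simp: qpair_def d less_mult_imp_div_less algebra_simps one_mult_mat_vec[OF assms(1)] one_mult_mat_vec[OF assms(2)])
qed

lemma implements_controlled:
  assumes g: "gate_op t m n Up Uq g = 1\<^sub>m t \<otimes>\<^sub>m X \<otimes>\<^sub>m 1\<^sub>m 2" and X: "unitary_mat (m * n * n) X" and b: "b < 2"
  shows "implements t m n Up Uq (m * n * n * 2) [Controlled b g] (ctl b X)"
proof (rule implements_single)
  note Xc = unitary_matD(1)[OF X]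
  \<comment> \<open>The identity on t * m * n * n dimensions is split so that the clock factor
    stands alone, as \<open>implements_single\<close> requires.\<close>
  have p: "proj_D t m n c = 1\<^sub>m t \<otimes>\<^sub>m (1\<^sub>m (m * n * n) \<otimes>\<^sub>m kb c)" for c
    by (simp add: proj_D_def mult.assoc tensor_mat_one flip: tensor_mat_assoc)
  have "gate_op t m n Up Uq (Controlled b g) =
      1\<^sub>m t \<otimes>\<^sub>m (X \<otimes>\<^sub>m kb b) + 1\<^sub>m t \<otimes>\<^sub>m (1\<^sub>m (m * n * n) \<otimes>\<^sub>m kb (1 - b))"
    unfolding gate_op.simps g p using Xc by (simp add: tensor_mat_mult)
  also have "\<dots> = 1\<^sub>m t \<otimes>\<^sub>m ctl b X"
    using Xc by (simp add: ctl_def tensor_mat_add_right)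
  finally show "gate_op t m n Up Uq (Controlled b g) = 1\<^sub>m t \<otimes>\<^sub>m ctl b X" .
  show "unitary_mat (m * n * n * 2) (ctl b X)" using X b by (rule unitary_ctl)
qed

text \<open>The copy gate is controlled along with the two oracle calls. Each of the three gates
  realises a \<open>ctl\<close>, and \<open>ctl_mult\<close> merges them.\<close>

lemma implements_tilde:
  assumes g: "gate_op t m n Up Uq g = 1\<^sub>m t \<otimes>\<^sub>m U \<otimes>\<^sub>m 1\<^sub>m n \<otimes>\<^sub>m 1\<^sub>m 2"
    and U: "unitary_mat (m * n) U" and V: "unitary_mat (n * n) V" and b: "b < 2"
  shows "implements t m n Up Uq (m * n * n * 2) (controlled_circuit b (tilde_circuit t m V g)) (ctl b (copied m n V U))"
proof -
  let ?U = "U \<otimes>\<^sub>m 1\<^sub>m n" and ?V = "1\<^sub>m m \<otimes>\<^sub>m V" and ?N = "m * n * n"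
  have u: "unitary_mat ?N ?U" "unitary_mat ?N ?V"
    using unitary_mat_tensor[OF U unitary_mat_one[of n]] unitary_mat_tensor[OF unitary_mat_one[of m] V]
    by (simp_all add: mult.assoc)
  have u': "unitary_mat ?N (mat_adjoint U \<otimes>\<^sub>m 1\<^sub>m n)"
    using unitary_mat_adjoint[OF u(1)] by (simp add: tensor_mat_adjoint)
  have 1: "implements t m n Up Uq (?N * 2) [Controlled b g] (ctl b ?U)"
    by (rule implements_controlled) (use g u b in \<open>simp_all add: tensor_mat_assoc\<close>)
  have 2: "implements t m n Up Uq (?N * 2) [Controlled b (Fixed (1\<^sub>m t \<otimes>\<^sub>m 1\<^sub>m m \<otimes>\<^sub>m V \<otimes>\<^sub>m 1\<^sub>m 2))] (ctl b ?V)"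
    by (rule implements_controlled) (use u b in \<open>simp_all add: tensor_mat_assoc\<close>)
  have 3: "implements t m n Up Uq (?N * 2) [Controlled b (Inverse g)] (ctl b (mat_adjoint U \<otimes>\<^sub>m 1\<^sub>m n))"
    by (rule implements_controlled) (use g u' b in \<open>simp_all add: tensor_mat_assoc tensor_mat_adjoint\<close>)
  have "ctl b (mat_adjoint U \<otimes>\<^sub>m 1\<^sub>m n) * (ctl b ?V * ctl b ?U) = ctl b (copied m n V U)"
    unfolding copied_def using unitary_matD(1)[OF u(1)] unitary_matD(1)[OF u(2)] unitary_matD(1)[OF u'] b
    by (simp add: ctl_mult[of _ ?N] mult_carrier_mat[of _ ?N ?N _ ?N])
  then show ?thesis
    using implements_append[OF implements_append[OF 1 2] 3]
    by (simp add: controlled_circuit_def tilde_circuit_def)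
qed

lemma implements_fixed_D:
  assumes "unitary_mat 2 B"
  shows "implements t m n Up Uq (m * n * n * 2) [Fixed (1\<^sub>m (t * m * n * n) \<otimes>\<^sub>m B)] (1\<^sub>m (m * n * n) \<otimes>\<^sub>m B)"
proof (rule implements_single)
  show "gate_op t m n Up Uq (Fixed (1\<^sub>m (t * m * n * n) \<otimes>\<^sub>m B)) = 1\<^sub>m t \<otimes>\<^sub>m (1\<^sub>m (m * n * n) \<otimes>\<^sub>m B)"
    by (simp add: mult.assoc tensor_mat_one flip: tensor_mat_assoc)
  show "unitary_mat (m * n * n * 2) (1\<^sub>m (m * n * n) \<otimes>\<^sub>m B)"
    using unitary_mat_tensor[OF unitary_mat_one assms] .
qed

section \<open>The subroutine U and its amplitude\<close>

definition U_mat :: "nat \<Rightarrow> nat \<Rightarrow> complex mat \<Rightarrow> complex mat \<Rightarrow> complex mat \<Rightarrow> complex mat" where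
  "U_mat m n V Up Uq = (1\<^sub>m (m * n * n) \<otimes>\<^sub>m hadamard) * (ctl 1 (copied m n V Uq) * (ctl 0 (copied m n V Up) *
     (1\<^sub>m (m * n * n) \<otimes>\<^sub>m (hadamard * pauli_x))))"

lemma implements_U_circuit:
  assumes "unitary_mat (m * n) Up" "unitary_mat (m * n) Uq" "unitary_mat (n * n) V"
  shows "implements t m n Up Uq (m * n * n * 2) (U_circuit t m n V) (U_mat m n V Up Uq)"
proof -
  have p: "implements t m n Up Uq (m * n * n * 2) (controlled_circuit 0 (tilde_circuit t m V Call_p)) (ctl 0 (copied m n V Up))"
    by (rule implements_tilde) (use assms in auto)
  have q: "implements t m n Up Uq (m * n * n * 2) (controlled_circuit 1 (tilde_circuit t m V Call_q)) (ctl 1 (copied m n V Uq))"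
    by (rule implements_tilde) (use assms in auto)
  note h = unitary_hadamard unitary_mat_mult[OF unitary_hadamard unitary_pauli_x]
  show ?thesis
    using implements_append[OF implements_append[OF implements_append[OF implements_fixed_D[OF h(2)] p] q] implements_fixed_D[OF h(1)]]
    by (simp add: U_circuit_def U_mat_def)
qed

lemma U_mat_amplitude:
  assumes p: "distribution n p" and q: "distribution n q"
    and z: "unit_vector m zA" "unit_vector n zB" "unit_vector n zC"
    and Up: "purified_access m n zA zB p Up" and Uq: "purified_access m n zA zB q Uq"
    and V: "copy_unitary n zC V"
  shows "Pi_proj n zA zB *\<^sub>v (U_mat m n V Up Uq *\<^sub>v init_state zA zB zC) =
    ((zA \<otimes>\<^sub>v zB) \<otimes>\<^sub>v vec n (\<lambda>i. complex_of_real ((p i - q i) / 2))) \<otimes>\<^sub>v unit_vec 2 0"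
proof -
  let ?N = "m * n * n"
  define w where "w = zA \<otimes>\<^sub>v zB \<otimes>\<^sub>v zC"
  define h where "h = complex_of_real (1 / sqrt 2)"
  \<comment> \<open>The first and the last Hadamard gate contribute one factor each; together they
    are the 1/2 in (p i - q i)/2.\<close>
  have hh: "h * h = 1 / 2" by (simp add: h_def flip: of_real_mult)
  have zs: "zA \<in> carrier_vec m" "zB \<in> carrier_vec n" "zC \<in> carrier_vec n"
    using z by (auto simp: unit_vector_def)
  have w: "w \<in> carrier_vec ?N" using zs by (simp add: w_def mult.assoc)
  have init: "init_state zA zB zC = w \<otimes>\<^sub>v unit_vec 2 0"
    by (simp add: init_state_def w_def tensor_vec_assoc)
  have U: "unitary_mat (m * n) Up" "unitary_mat (m * n) Uq" "unitary_mat (n * n) V"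
    using Up Uq V by (auto simp: purified_access_def copy_unitary_def)
  have cc: "copied m n V U \<in> carrier_mat ?N ?N" if "unitary_mat (m * n) U" for U
  proof -
    have "U \<otimes>\<^sub>m 1\<^sub>m n \<in> carrier_mat ?N ?N" "mat_adjoint U \<otimes>\<^sub>m 1\<^sub>m n \<in> carrier_mat ?N ?N"
      using unitary_matD(1)[OF that] by simp_all
    moreover have "1\<^sub>m m \<otimes>\<^sub>m V \<in> carrier_mat ?N ?N"
      using tensor_mat_carrier[OF one_carrier_mat[of m] unitary_matD(1)[OF U(3)]] by (simp add: mult.assoc)
    ultimately show ?thesis unfolding copied_def by (metis mult_carrier_mat)
  qed
  let ?P = "copied m n V Up" and ?Q = "copied m n V Uq"
  define R where "R = ket_bra zA \<otimes>\<^sub>m ket_bra zB \<otimes>\<^sub>m 1\<^sub>m n"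
  have R: "R \<in> carrier_mat ?N ?N" using zs by (simp add: R_def mult.assoc)
  have Pi: "Pi_proj n zA zB = R \<otimes>\<^sub>m kb 0" by (simp add: Pi_proj_def R_def tensor_mat_assoc)
  let ?x = "?P *\<^sub>v (h \<cdot>\<^sub>v w)" and ?y = "?Q *\<^sub>v (- h \<cdot>\<^sub>v w)"
  have hw: "h \<cdot>\<^sub>v w \<in> carrier_vec ?N" "- h \<cdot>\<^sub>v w \<in> carrier_vec ?N" using w by auto
  have x: "?x \<in> carrier_vec ?N" and y: "?y \<in> carrier_vec ?N"
    using mult_mat_vec_carrier[OF cc hw(1)] mult_mat_vec_carrier[OF cc hw(2)] U by auto
  have m1: "1\<^sub>m ?N \<otimes>\<^sub>m hadamard \<in> carrier_mat (?N * 2) (?N * 2)"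
    "1\<^sub>m ?N \<otimes>\<^sub>m (hadamard * pauli_x) \<in> carrier_mat (?N * 2) (?N * 2)"
    using unitary_matD(1)[OF unitary_hadamard]
      unitary_matD(1)[OF unitary_mat_mult[OF unitary_hadamard unitary_pauli_x]]
    by simp_all
  note m2 = ctl_carrier[OF cc[OF U(1)], of 0] ctl_carrier[OF cc[OF U(2)], of 1]
  have w0: "w \<otimes>\<^sub>v unit_vec 2 0 \<in> carrier_vec (?N * 2)" using w by simp
  have "U_mat m n V Up Uq *\<^sub>v init_state zA zB zC = (1\<^sub>m ?N \<otimes>\<^sub>m hadamard) *\<^sub>v (ctl 1 ?Q *\<^sub>v (ctl 0 ?P *\<^sub>v
      ((1\<^sub>m ?N \<otimes>\<^sub>m (hadamard * pauli_x)) *\<^sub>v (w \<otimes>\<^sub>v unit_vec 2 0))))"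
    unfolding U_mat_def init
    by (simp only: assoc_mult_mat_vec[OF m1(1) mult_carrier_mat[OF m2(2) mult_carrier_mat[OF m2(1) m1(2)]] w0]
        assoc_mult_mat_vec[OF m2(2) mult_carrier_mat[OF m2(1) m1(2)] w0] assoc_mult_mat_vec[OF m2(1) m1(2) w0])
  also have "\<dots> = qpair (h \<cdot>\<^sub>v (?x + ?y)) (h \<cdot>\<^sub>v (?x - ?y))"
    using hadamard_pauli_x_tensor[OF w] ctl_qpair[OF cc[OF U(1)] hw] ctl_qpair[OF cc[OF U(2)] x hw(2)]
      hadamard_qpair[OF x y]
    by (simp add: h_def)
  finally have "Pi_proj n zA zB *\<^sub>v (U_mat m n V Up Uq *\<^sub>v init_state zA zB zC) = (R *\<^sub>v (h \<cdot>\<^sub>v (?x + ?y))) \<otimes>\<^sub>v unit_vec 2 0"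
    unfolding Pi using x y by (simp add: proj_qpair[OF R])
  also have "R *\<^sub>v (h \<cdot>\<^sub>v (?x + ?y)) = h \<cdot>\<^sub>v (R *\<^sub>v ?x + R *\<^sub>v ?y)"
    using x y by (simp add: mult_mat_vec[OF R] mult_add_distrib_mat_vec[OF R])
  also have "R *\<^sub>v ?x = h \<cdot>\<^sub>v ((zA \<otimes>\<^sub>v zB) \<otimes>\<^sub>v vec n (\<lambda>i. complex_of_real (p i)))"
  proof -
    have "?x = h \<cdot>\<^sub>v (?P *\<^sub>v w)" by (rule mult_mat_vec[OF cc[OF U(1)] w])
    moreover have "R *\<^sub>v (h \<cdot>\<^sub>v (?P *\<^sub>v w)) = h \<cdot>\<^sub>v (R *\<^sub>v (?P *\<^sub>v w))"
      by (rule mult_mat_vec[OF R mult_mat_vec_carrier[OF cc[OF U(1)] w]])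
    ultimately show ?thesis
      using copied_overlap[OF z _ Up V] p unfolding R_def w_def distribution_def by simp
  qed
  also have "R *\<^sub>v ?y = - h \<cdot>\<^sub>v ((zA \<otimes>\<^sub>v zB) \<otimes>\<^sub>v vec n (\<lambda>i. complex_of_real (q i)))"
  proof -
    have "?y = - h \<cdot>\<^sub>v (?Q *\<^sub>v w)" by (rule mult_mat_vec[OF cc[OF U(2)] w])
    moreover have "R *\<^sub>v (- h \<cdot>\<^sub>v (?Q *\<^sub>v w)) = - h \<cdot>\<^sub>v (R *\<^sub>v (?Q *\<^sub>v w))"
      by (rule mult_mat_vec[OF R mult_mat_vec_carrier[OF cc[OF U(2)] w]])
    ultimately show ?thesis
      using copied_overlap[OF z _ Uq V] q unfolding R_def w_def distribution_def by simp
  qed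
  also have "h \<cdot>\<^sub>v (h \<cdot>\<^sub>v ((zA \<otimes>\<^sub>v zB) \<otimes>\<^sub>v vec n (\<lambda>i. complex_of_real (p i))) +
      - h \<cdot>\<^sub>v ((zA \<otimes>\<^sub>v zB) \<otimes>\<^sub>v vec n (\<lambda>i. complex_of_real (q i)))) =
      (zA \<otimes>\<^sub>v zB) \<otimes>\<^sub>v vec n (\<lambda>i. complex_of_real ((p i - q i) / 2))" (is "?l = ?r")
  proof (rule eq_vecI)
    fix k assume "k < dim_vec ?r"
    then have k: "k < (m * n) * n" using zs by simp
    have hx: "h * (h * u) = u / 2" for u by (simp add: hh flip: mult.assoc)
    show "?l $ k = ?r $ k"
      using k zs tensor_index_bounds[OF k] by (simp add: algebra_simps hx diff_divide_distrib)
  qed (use zs in simp)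
  finally show ?thesis .
qed

lemma cscalar_prod_U_mat_amplitude:
  fixes p q :: "nat \<Rightarrow> real"
  assumes "unit_vector m zA" "unit_vector n zB"
  defines "v \<equiv> ((zA \<otimes>\<^sub>v zB) \<otimes>\<^sub>v vec n (\<lambda>i. complex_of_real ((p i - q i) / 2))) \<otimes>\<^sub>v unit_vec 2 0"
  shows "Re (v \<bullet>c v) = (l2_dist n p q / 2)\<^sup>2"
proof -
  have "v \<bullet>c v = (zA \<bullet>c zA) * (zB \<bullet>c zB) * (vec n (\<lambda>i. complex_of_real ((p i - q i) / 2)) \<bullet>c
      vec n (\<lambda>i. complex_of_real ((p i - q i) / 2))) * (unit_vec 2 0 \<bullet>c unit_vec 2 0)"
    unfolding v_def by (simp add: tensor_cscalar_prod)
  also have "\<dots> = (\<Sum>i<n. complex_of_real (((p i - q i) / 2)\<^sup>2))"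
    using assms(1,2) by (simp add: unit_vector_def cscalar_prod_unit_vec) (simp add: cscalar_prod_sum power2_eq_square)
  also have "\<dots> = complex_of_real (\<Sum>i<n. ((p i - q i) / 2)\<^sup>2)" by simp
  also have "(\<Sum>i<n. ((p i - q i) / 2)\<^sup>2) = (l2_dist n p q / 2)\<^sup>2"
    by (simp add: l2_dist_def power_divide sum_nonneg flip: sum_divide_distrib)
  finally show ?thesis by (simp only: Re_complex_of_real)
qed

lemma Pi_proj_projector:
  assumes "unit_vector m zA" "unit_vector n zB"
  shows "Pi_proj n zA zB \<in> carrier_mat (m * n * n * 2) (m * n * n * 2)"
    "Pi_proj n zA zB * Pi_proj n zA zB = Pi_proj n zA zB"
    "mat_adjoint (Pi_proj n zA zB) = Pi_proj n zA zB"
proof -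
  have z: "zA \<in> carrier_vec m" "zB \<in> carrier_vec n" "zA \<bullet>c zA = 1" "zB \<bullet>c zB = 1"
    using assms by (auto simp: unit_vector_def)
  show "Pi_proj n zA zB \<in> carrier_mat (m * n * n * 2) (m * n * n * 2)"
    using z by (intro carrier_matI) (simp_all add: Pi_proj_def)
  show "Pi_proj n zA zB * Pi_proj n zA zB = Pi_proj n zA zB"
    using z by (simp add: Pi_proj_def tensor_mat_mult ket_bra_idem cscalar_prod_unit_vec)
  show "mat_adjoint (Pi_proj n zA zB) = Pi_proj n zA zB"
    by (simp add: Pi_proj_def tensor_mat_adjoint)
qed

lemma unit_vector_init_state:
  assumes "unit_vector m zA" "unit_vector n zB" "unit_vector n zC"
  shows "unit_vector (m * n * n * 2) (init_state zA zB zC)"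
proof -
  have "zA \<in> carrier_vec m" "zB \<in> carrier_vec n" "zC \<in> carrier_vec n"
    using assms by (auto simp: unit_vector_def)
  then have "init_state zA zB zC \<in> carrier_vec (m * n * n * 2)"
    by (intro carrier_vecI) (simp add: init_state_def)
  then show ?thesis
    using assms by (simp add: unit_vector_def init_state_def tensor_cscalar_prod cscalar_prod_unit_vec)
qed

section \<open>Number of calls and decision rule\<close>

lemma num_calls_append [simp]: "num_calls (c @ c') = num_calls c + num_calls c'"
  by (simp add: num_calls_def)

lemma num_calls_inverse [simp]: "num_calls (inverse_circuit c) = num_calls c"
  by (simp add: num_calls_def inverse_circuit_def rev_map[symmetric] comp_def)

lemma num_calls_concat: "num_calls (concat (map f xs)) = (\<Sum>x\<leftarrow>xs. num_calls (f x))"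
  by (induction xs) (simp_all add: num_calls_def)

lemma num_calls_Cons [simp]: "num_calls (g # c) = gate_calls g + num_calls c"
  by (simp add: num_calls_def)

lemma num_calls_Nil [simp]: "num_calls [] = 0"
  by (simp add: num_calls_def)

lemma num_calls_U_circuit: "num_calls (U_circuit t m n V) = 4"
  by (simp add: num_calls_def U_circuit_def controlled_circuit_def tilde_circuit_def)

text \<open>The subroutine runs once for preparation and twice, once inverted, in each of t - 1
  rounds. With 4 calls per run this gives 4(2t - 1), which is below 8t.\<close>

lemma num_calls_amp_est: "num_calls (amp_est_circuit t s \<psi> P cU) = num_calls cU + (t - 1) * (2 * num_calls cU)"
  by (simp add: amp_est_circuit_def num_calls_concat sum_list_triv)

lemma num_calls_T_circuit:
  assumes "0 < \<nu>" "\<nu> \<le> 1" "0 < \<epsilon>" "\<epsilon> < 1"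
  shows "real (num_calls (T_circuit m n zA zB zC V \<nu> \<epsilon>)) \<le> 8 * (10 * pi + 1) * (1 / (\<nu> * \<epsilon>))"
proof -
  let ?t = "T_iterations \<nu> \<epsilon>"
  have pos: "0 < \<nu> * \<epsilon>" using assms by simp
  have "\<nu> * \<epsilon> \<le> 1" using assms by (simp add: mult_le_one)
  \<comment> \<open>Used to absorb the additive 1 from rounding t up.\<close>
  then have 1: "1 \<le> 1 / (\<nu> * \<epsilon>)" using pos by simp
  have "0 < 10 * pi / (\<nu> * \<epsilon>)" using pos by simp
  then have t: "0 < ?t" "real ?t \<le> 10 * pi / (\<nu> * \<epsilon>) + 1" unfolding T_iterations_def by linarith+
  have "real (num_calls (T_circuit m n zA zB zC V \<nu> \<epsilon>)) \<le> 8 * real ?t"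
    using t(1) by (simp add: T_circuit_def Let_def num_calls_amp_est num_calls_U_circuit of_nat_diff)
  also have "\<dots> \<le> 8 * (10 * pi / (\<nu> * \<epsilon>) + 1 / (\<nu> * \<epsilon>))" using t(2) 1 by simp
  also have "\<dots> = 8 * (10 * pi + 1) * (1 / (\<nu> * \<epsilon>))"
    by (simp add: add_divide_distrib distrib_left distrib_right)
  finally show ?thesis .
qed

text \<open>Serves both outcomes: hypothesis \<open>d\<close> isolates what the decision rule has to
  satisfy, namely a constant answer for all estimates whose square root is within \<nu>\<epsilon>/10
  of half the distance.\<close>

lemma T_prob_ge:
  assumes p: "distribution n p" and q: "distribution n q"
    and z: "unit_vector m zA" "unit_vector n zB" "unit_vector n zC"
    and Up: "purified_access m n zA zB p Up" and Uq: "purified_access m n zA zB q Uq"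
    and V: "copy_unitary n zC V"
    and \<nu>: "0 < \<nu>" "\<nu> \<le> 1" and \<epsilon>: "0 < \<epsilon>" "\<epsilon> < 1"
    and d: "\<And>\<sigma>. \<bar>\<bar>\<sigma>\<bar> - l2_dist n p q / 2\<bar> \<le> \<nu> * \<epsilon> / 10 \<Longrightarrow> T_decision \<nu> \<epsilon> (\<sigma>\<^sup>2) = d"
  shows "2/3 \<le> T_prob m n zA zB zC V \<nu> \<epsilon> Up Uq d"
proof -
  define t where "t = T_iterations \<nu> \<epsilon>"
  have pos: "0 < \<nu> * \<epsilon>" using \<nu> \<epsilon> by simp
  have t_ge: "10 * pi / (\<nu> * \<epsilon>) \<le> real t" unfolding t_def T_iterations_def by linarith
  \<comment> \<open>Since \<nu>\<epsilon> \<le> 1, the number t is at least 10 pi, which covers the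
    requirement t \<ge> 3 of \<open>estimate_prob\<close>.\<close>
  have "10 * pi \<le> 10 * pi / (\<nu> * \<epsilon>)" using pos \<nu> \<epsilon> by (simp add: pos_le_divide_eq mult_le_one)
  then have "3 \<le> real t" using t_ge pi_ge_two by linarith
  then have t3: "3 \<le> t" by simp
  have step: "pi / real t \<le> \<nu> * \<epsilon> / 10"
    using t_ge pos t3 by (simp add: field_simps)
  let ?s = "m * n * n * 2" and ?W = "U_mat m n V Up Uq"
  interpret amp_est t m n ?s Up Uq "init_state zA zB zC" "Pi_proj n zA zB" ?W "U_circuit t m n V"
  proof
    show "0 < t" using t3 by simp
    show "unit_vector ?s (init_state zA zB zC)" using z by (rule unit_vector_init_state)
    show "implements t m n Up Uq ?s (U_circuit t m n V) ?W"
      using Up Uq V by (intro implements_U_circuit) (auto simp: purified_access_def copy_unitary_def)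
  qed (use Pi_proj_projector[OF z(1,2)] in auto)
  define l where "l = l2_dist n p q / 2"
  have amp: "amp = l\<^sup>2"
    unfolding U_mat_amplitude[OF p q z Up Uq V] l_def by (rule cscalar_prod_U_mat_amplitude[OF z(1,2)])
  have "0 \<le> l" by (simp add: l_def l2_dist_def sum_nonneg)
  \<comment> \<open>That half the distance is a legitimate argument of arcsin comes from its being
    an amplitude; the distance is not estimated directly.\<close>
  moreover have "l \<le> 1" using amp_le_1 unfolding amp by (simp add: power_le_one_iff abs_square_le_1 \<open>0 \<le> l\<close>)
  ultimately have \<theta>: "sin (arcsin l) = l" "0 \<le> arcsin l" "arcsin l \<le> pi / 2"
    using arcsin_bounded[of l] arcsin_le_arcsin[of 0 l] by auto
  have "2/3 \<le> (\<Sum>y | y < t \<and> T_decision \<nu> \<epsilon> (amp_est_value t y) = d.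
      outcome_prob t ?s (run_circuit t m n Up Uq (amp_est_circuit t ?s (init_state zA zB zC) (Pi_proj n zA zB)
        (U_circuit t m n V)) (unit_vec t 0 \<otimes>\<^sub>v init_state zA zB zC)) y)"
  proof (rule estimate_prob[OF _ \<theta>(2,3) t3])
    fix y assume y: "y < t" and "\<bar>\<bar>sin (pi * real y / real t)\<bar> - \<bar>sin (arcsin l)\<bar>\<bar> \<le> pi / real t"
    then have "\<bar>\<bar>sin (pi * real y / real t)\<bar> - l\<bar> \<le> \<nu> * \<epsilon> / 10"
      using step \<open>0 \<le> l\<close> unfolding \<theta>(1) by linarith
    then have "T_decision \<nu> \<epsilon> ((sin (pi * real y / real t))\<^sup>2) = d"
      unfolding l_def by (rule d)
    then show "y \<in> {y. y < t \<and> T_decision \<nu> \<epsilon> (amp_est_value t y) = d}"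
      using y by (simp add: amp_est_value_def)
  qed (auto simp: \<theta>(1) amp)
  then show ?thesis
    by (simp only: T_prob_def T_circuit_def Let_def t_def[symmetric])
qed

lemma T_decision_CLOSE:
  assumes "0 < \<nu>" "\<nu> \<le> 1" "0 < \<epsilon>" "d \<le> (1 - \<nu>) * \<epsilon>" "\<bar>\<bar>\<sigma>\<bar> - d / 2\<bar> \<le> \<nu> * \<epsilon> / 10"
  shows "T_decision \<nu> \<epsilon> (\<sigma>\<^sup>2) = CLOSE"
proof -
  have "\<bar>\<sigma>\<bar> \<le> (1 - \<nu>) * \<epsilon> / 2 + \<nu> * \<epsilon> / 10" using assms(4,5) by linarith
  also have "\<dots> = (1/2 - 2/5 * \<nu>) * \<epsilon>" by (simp add: field_simps)
  finally have "\<bar>\<sigma>\<bar>\<^sup>2 \<le> ((1/2 - 2/5 * \<nu>) * \<epsilon>)\<^sup>2" by (intro power_mono) auto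
  then have "\<sigma>\<^sup>2 \<le> (1/2 - 2/5 * \<nu>)\<^sup>2 * \<epsilon>\<^sup>2" by (simp add: power_mult_distrib)
  also have "\<dots> < (1/4 - \<nu>/8) * \<epsilon>\<^sup>2"
  proof (rule mult_strict_right_mono)
    \<comment> \<open>The square is 1/4 - 2\<nu>/5 + 4\<nu>^2/25, at most 1/4 - 6\<nu>/25, and 6/25
      exceeds 1/8.\<close>
    have "\<nu> * \<nu> \<le> \<nu>" using assms(1,2) by (simp add: mult_left_le)
    then show "(1/2 - 2/5 * \<nu>)\<^sup>2 < 1/4 - \<nu>/8"
      using assms(1) by (simp add: power2_eq_square algebra_simps)
  qed (use assms(3) in simp)
  finally show ?thesis by (simp add: T_decision_def)
qed

lemma T_decision_FAR:
  assumes "0 < \<nu>" "\<nu> \<le> 1" "0 < \<epsilon>" "\<epsilon> \<le> d" "\<bar>\<bar>\<sigma>\<bar> - d / 2\<bar> \<le> \<nu> * \<epsilon> / 10"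
  shows "T_decision \<nu> \<epsilon> (\<sigma>\<^sup>2) = FAR"
proof -
  have "(1/2 - \<nu>/10) * \<epsilon> = \<epsilon> / 2 - \<nu> * \<epsilon> / 10" by (simp add: algebra_simps)
  also have "\<dots> \<le> \<bar>\<sigma>\<bar>" using assms(4,5) by linarith
  finally have "((1/2 - \<nu>/10) * \<epsilon>)\<^sup>2 \<le> \<bar>\<sigma>\<bar>\<^sup>2" using assms by (intro power_mono) auto
  then have "(1/2 - \<nu>/10)\<^sup>2 * \<epsilon>\<^sup>2 \<le> \<sigma>\<^sup>2" by (simp add: power_mult_distrib)
  \<comment> \<open>The square is 1/4 - \<nu>/10 + \<nu>^2/100, and 1/10 is below 1/8.\<close>
  moreover have "(1/4 - \<nu>/8) * \<epsilon>\<^sup>2 \<le> (1/2 - \<nu>/10)\<^sup>2 * \<epsilon>\<^sup>2"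
    using assms(1) by (intro mult_right_mono) (auto simp: power2_eq_square algebra_simps)
  ultimately show ?thesis by (simp add: T_decision_def)
qed

theorem theorem4:
  "\<exists>K::real. \<forall>(n::nat) (m::nat) (p::nat \<Rightarrow> real) (q::nat \<Rightarrow> real)
      (zA::complex vec) (zB::complex vec) (zC::complex vec)
      (Up::complex mat) (Uq::complex mat) (Ucopy::complex mat) (\<nu>::real) (\<epsilon>::real).
    distribution n p \<and> distribution n q \<and>
    unit_vector m zA \<and> unit_vector n zB \<and> unit_vector n zC \<and>
    purified_access m n zA zB p Up \<and> purified_access m n zA zB q Uq \<and>
    copy_unitary n zC Ucopy \<and>
    0 < \<nu> \<and> \<nu> \<le> 1 \<and> 0 < \<epsilon> \<and> \<epsilon> < 1 \<longrightarrow>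
      (l2_dist n p q \<le> (1 - \<nu>) * \<epsilon> \<longrightarrow>
         T_prob m n zA zB zC Ucopy \<nu> \<epsilon> Up Uq CLOSE \<ge> 2/3) \<and>
      (l2_dist n p q \<ge> \<epsilon> \<longrightarrow>
         T_prob m n zA zB zC Ucopy \<nu> \<epsilon> Up Uq FAR \<ge> 2/3) \<and>
      real (num_calls (T_circuit m n zA zB zC Ucopy \<nu> \<epsilon>)) \<le> K * (1 / (\<nu> * \<epsilon>))"
proof -
  have "(l2_dist n p q \<le> (1 - \<nu>) * \<epsilon> \<longrightarrow> 2/3 \<le> T_prob m n zA zB zC Ucopy \<nu> \<epsilon> Up Uq CLOSE) \<and>
      (l2_dist n p q \<ge> \<epsilon> \<longrightarrow> 2/3 \<le> T_prob m n zA zB zC Ucopy \<nu> \<epsilon> Up Uq FAR) \<and>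
      real (num_calls (T_circuit m n zA zB zC Ucopy \<nu> \<epsilon>)) \<le> 8 * (10 * pi + 1) * (1 / (\<nu> * \<epsilon>))"
    if a: "distribution n p" "distribution n q" "unit_vector m zA" "unit_vector n zB" "unit_vector n zC"
      "purified_access m n zA zB p Up" "purified_access m n zA zB q Uq" "copy_unitary n zC Ucopy"
      "0 < \<nu>" "\<nu> \<le> 1" "0 < \<epsilon>" "\<epsilon> < 1"
    for n m p q zA zB zC Up Uq Ucopy \<nu> \<epsilon>
    using T_prob_ge[OF a] T_decision_CLOSE[OF a(9-11)] T_decision_FAR[OF a(9-11)]
      num_calls_T_circuit[OF a(9-12)] by blast
  then show ?thesis by blast
qed

end
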